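(* Let $n_r$ receiver positions $\mathbf{b}_1,\dots,\mathbf{b}_{n_r}\in\mathbb{R}^3$ be given, at least four of which are non-coplanar. Suppose that there are constants $R_{min},R_{max}>0$ such that $R_{min}\le\rho_i(t)\le R_{max}$ for all $t\ge t_0$ and $i=1,\dots,n_r$, and that the signals $\mathbf{r}(t)$, $\omega(t)$, $\mathbf{v}(t)$, their time derivatives $\dot{\mathbf{r}}(t)$, $\dot{\omega}(t)$, $\dot{\mathbf{v}}(t)$, and the derivatives $\dot{\rho}_i(t)$, $i=1,\dots,n_r$, are bounded on $[t_0,\infty)$. Then the linear time-varying system $$\dot{\mathbf{x}}(t)=\mathbf{A}(t)\mathbf{x}(t)+\mathbf{B}(t)\mathbf{u}(t),\qquad \mathbf{y}(t)=\mathbf{C}(t)\mathbf{x}(t),$$ with $\mathbf{x}(t)\in\mathbb{R}^{8+n_r}$ and with $\mathbf{A},\mathbf{B},\mathbf{C}$ as defined in the context, is uniformly completely observable, that is, there exist positive constants $\alpha_1,\alpha_2,\delta$ such that $$\alpha_1\mathbf{I}\preceq\mathcal{W}(t,t+\delta)\preceq\alpha_2\mathbf{I}\qquad\text{for all }t\ge t_0,$$ where $\mathcal{W}(t,t+\delta)=\int_t^{t+\delta}\Phi^T(\tau,t)\mathbf{C}^T(\tau)\mathbf{C}(\tau)\Phi(\tau,t)\,d\tau$ is the observability Gramian and $\Phi(\tau,t)$ is the state transition matrix associated with $\mathbf{A}$.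
   Context: **Signals.** $\mathcal{R}(t)\in SO(3)$ is a rotation matrix (from a body-fixed frame to an inertial frame) satisfying $\dot{\mathcal{R}}(t)=\mathcal{R}(t)\mathcal{S}(\omega(t))$, where $\omega(t)\in\mathbb{R}^3$ is the angular velocity and $\mathcal{S}(\omega)$ is the skew-symmetric matrix with $\mathcal{S}(\omega)a=\omega\times a$. $\mathbf{r}(t)\in\mathbb{R}^3$ is the position of a fixed transponder in the body-fixed frame, $\mathbf{v}(t)\in\mathbb{R}^3$ is the vehicle velocity in body-fixed coordinates, ${}^I\mathbf{v}_c\in\mathbb{R}^3$ is a constant (inertial current velocity), $\mathbf{v}_c(t)=\mathcal{R}^T(t)\,{}^I\mathbf{v}_c$, and $\mathbf{v}_r(t)=\mathbf{v}(t)-\mathbf{v}_c(t)$ is the measured relative velocity. They satisfy $$\dot{\mathbf{r}}(t)=-\mathcal{S}(\omega(t))\mathbf{r}(t)-\mathbf{v}_c(t)-\mathbf{v}_r(t),\qquad \dot{\mathbf{v}}_c(t)=-\mathcal{S}(\omega(t))\mathbf{v}_c(t),\qquad \rho_i(t)=\|\mathbf{b}_i-\mathbf{r}(t)\|,\ i=1,\dots,n_r .$$ The input is $\mathbf{u}(t)=\mathcal{R}(t)\mathbf{v}_r(t)$, a known continuous bounded signal. The signals $\mathcal{R},\omega,\mathbf{u},\rho_1,\dots,\rho_{n_r}$ along this fixed trajectory are treated as known functions of time, so that $\mathbf{A},\mathbf{B},\mathbf{C}$ below are known functions of time. **Matrices.** Split a vector of $\mathbb{R}^{8+n_r}$ into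 blocks of sizes $3,3,n_r,1,1$. With respect to this splitting, $$\mathbf{A}(t)=\begin{bmatrix}\mathbf{0}&-\mathbf{I}&\mathbf{0}&\mathbf{0}&\mathbf{0}\\ \mathbf{0}&\mathbf{0}&\mathbf{0}&\mathbf{0}&\mathbf{0}\\ \frac{\mathbf{b}_1^T\mathcal{S}(\omega(t))\mathcal{R}^T(t)-\mathbf{u}^T(t)}{\rho_1(t)}&\frac{\mathbf{b}_1^T\mathcal{R}^T(t)}{\rho_1(t)}&\mathbf{0}&-\frac1{\rho_1(t)}&0\\ \vdots&\vdots&\vdots&\vdots&\vdots\\ \frac{\mathbf{b}_{n_r}^T\mathcal{S}(\omega(t))\mathcal{R}^T(t)-\mathbf{u}^T(t)}{\rho_{n_r}(t)}&\frac{\mathbf{b}_{n_r}^T\mathcal{R}^T(t)}{\rho_{n_r}(t)}&\mathbf{0}&-\frac1{\rho_{n_r}(t)}&0\\ \mathbf{0}&-\mathbf{u}^T(t)&\mathbf{0}&0&-1\\ \mathbf{0}&\mathbf{0}&\mathbf{0}&0&0\end{bmatrix},$$ $$\mathbf{B}(t)=\begin{bmatrix}-\mathbf{I}_3&\mathbf{0}&\frac{\mathcal{R}(t)\mathbf{b}_1}{\rho_1(t)}&\cdots&\frac{\mathcal{R}(t)\mathbf{b}_{n_r}}{\rho_{n_r}(t)}&\mathbf{0}&\mathbf{0}\end{bmatrix}^T,\qquad \mathbf{C}(t)=\begin{bmatrix}\mathbf{0}_{n_r\times3}&\mathbf{0}_{n_r\times3}&\mathbf{C}_0&\mathbf{0}_{n_r\times2}\\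 \mathbf{C}_1(t)&\mathbf{0}_{n_C\times3}&\mathbf{C}_2&\mathbf{0}_{n_C\times2}\end{bmatrix},$$ where $n_C=n_r(n_r-1)/2$. Let $e_1,\dots,e_{n_r}$ be the standard basis of $\mathbb{R}^{n_r}$. $\mathbf{C}_0\in\mathbb{R}^{n_r\times n_r}$ has first row $e_1^T$ and $k$-th row $(e_1-e_k)^T$ for $k=2,\dots,n_r$. The rows of $\mathbf{C}_1(t)\in\mathbb{R}^{n_C\times3}$ and $\mathbf{C}_2\in\mathbb{R}^{n_C\times n_r}$ are indexed by the pairs $(i,j)$, $1\le i<j\le n_r$, in lexicographic order; the $(i,j)$ rows are respectively $\frac{2(\mathbf{b}_i-\mathbf{b}_j)^T\mathcal{R}^T(t)}{\rho_i(t)+\rho_j(t)}$ and $(e_i-e_j)^T$. The relation $\preceq$ is the Loewner order on symmetric matrices. *)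

theory Defs
  imports "HOL-Analysis.Analysis"
begin

section \<open>Block matrices\<close>

text \<open>A block splitting of a vector is a sum of finite index types.\<close>

definition hcat :: "real^'a^'m \<Rightarrow> real^'b^'m \<Rightarrow> real^('a + 'b)^'m" (infixr \<open>|||\<close> 62) where
  "P ||| Q = (\<chi> i k. case k of Inl a \<Rightarrow> P $ i $ a | Inr b \<Rightarrow> Q $ i $ b)"

definition vcat :: "real^'n^'a \<Rightarrow> real^'n^'b \<Rightarrow> real^'n^('a + 'b)" (infixr \<open>;;\<close> 61) where
  "P ;; Q = (\<chi> k. case k of Inl a \<Rightarrow> P $ a | Inr b \<Rightarrow> Q $ b)"


section \<open>Linear time-varying systems and uniform complete observability\<close>

record ('n, 'm, 'p) ltv_system =
  state_mat  :: "real \<Rightarrow> real^'n^'n"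
  input_mat  :: "real \<Rightarrow> real^'m^'n"
  output_mat :: "real \<Rightarrow> real^'n^'p"

text \<open>The state transition matrix \<open>\<Phi>(\<tau>, s)\<close>, for \<open>s \<le> \<tau>\<close>: the value at time \<open>\<tau>\<close> of the solution
  on \<open>[s, \<tau>]\<close> of \<open>X' = A X\<close>, \<open>X(s) = I\<close>.\<close>

definition transition_matrix :: "(real \<Rightarrow> real^'n^'n) \<Rightarrow> real \<Rightarrow> real \<Rightarrow> real^'n^'n" where
  "transition_matrix A \<tau> s = (THE M. \<exists>X. X s = mat 1 \<and>
     (\<forall>t\<in>{s..\<tau>}. (X has_vector_derivative A t ** X t) (at t within {s..\<tau>})) \<and> X \<tau> = M)"

definition observability_gramian ::
    "('n::finite, 'm::finite, 'p::finite) ltv_system \<Rightarrow> real \<Rightarrow> real \<Rightarrow> real^'n^'n" where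
  "observability_gramian sys t T = integral {t..T} (\<lambda>\<tau>.
     transpose (transition_matrix (state_mat sys) \<tau> t) ** transpose (output_mat sys \<tau>) **
     output_mat sys \<tau> ** transition_matrix (state_mat sys) \<tau> t)"

definition loewner_le :: "real^'n^'n \<Rightarrow> real^'n^'n \<Rightarrow> bool" (infix \<open>\<preceq>\<^sub>L\<close> 50) where
  "P \<preceq>\<^sub>L Q \<longleftrightarrow> transpose P = P \<and> transpose Q = Q \<and> (\<forall>x. 0 \<le> x \<bullet> ((Q - P) *v x))"

definition uniformly_completely_observable ::
    "real \<Rightarrow> ('n::finite, 'm::finite, 'p::finite) ltv_system \<Rightarrow> bool" where
  "uniformly_completely_observable t0 sys \<longleftrightarrow>
     (\<exists>\<alpha>1>0. \<exists>\<alpha>2>0. \<exists>\<delta>>0. \<forall>t\<ge>t0.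
        \<alpha>1 *\<^sub>R mat 1 \<preceq>\<^sub>L observability_gramian sys t (t + \<delta>) \<and>
        observability_gramian sys t (t + \<delta>) \<preceq>\<^sub>L \<alpha>2 *\<^sub>R mat 1)"


section \<open>The range-based navigation system\<close>

text \<open>The receivers are indexed by a finite linearly ordered type \<open>'n\<close> in the role of
  \<open>{1, \<dots>, n\<^sub>r}\<close>; its least element is the index \<open>1\<close>. The type below, of the pairs
  \<open>i < j\<close>, is inhabited as soon as there are at least two receivers.\<close>

typedef (overloaded) ('n::"{card2, linorder}") receiver_pair = "{(i::'n, j). i < j}"
proof -
  have "\<exists>x y :: 'n. x \<noteq> y"
  proof (rule ccontr)
    assume "\<not> ?thesis"
    then have "(UNIV :: 'n set) = {undefined}" by auto
    then have "CARD('n) = 1" by (metis card.empty card_insert_disjoint empty_iff finite.emptyI One_nat_def)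
    then show False using two_le_card[where 'a = 'n] by simp
  qed
  then show ?thesis by (auto simp: neq_iff)
qed

instance receiver_pair :: ("{card2, linorder}") finite
proof
  have "finite (Rep_receiver_pair ` (UNIV :: 'a receiver_pair set))" by simp
  then show "finite (UNIV :: 'a receiver_pair set)"
    by (rule finite_imageD) (simp add: inj_on_def Rep_receiver_pair_inject)
qed

definition skew :: "real^3 \<Rightarrow> real^3^3" where
  "skew w = matrix (cross3 w)"

type_synonym 'n state_index = "3 + 3 + 'n + 1 + 1"

definition sys_A :: "('n::finite \<Rightarrow> real^3) \<Rightarrow> (real \<Rightarrow> real^3^3) \<Rightarrow> (real \<Rightarrow> real^3) \<Rightarrow> (real \<Rightarrow> real^3) \<Rightarrow>
    ('n \<Rightarrow> real \<Rightarrow> real) \<Rightarrow> real \<Rightarrow> real^('n state_index)^('n state_index)" where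
  "sys_A b R \<omega> u \<rho> t =
     (0 ||| - mat 1 ||| 0 ||| 0 ||| 0) ;;
     (0 ||| 0 ||| 0 ||| 0 ||| 0) ;;
     ((\<chi> i. (1 / \<rho> i t) *\<^sub>R (b i v* (skew (\<omega> t) ** transpose (R t)) - u t)) |||
        (\<chi> i. (1 / \<rho> i t) *\<^sub>R (b i v* transpose (R t))) ||| 0 ||| (\<chi> i j. - 1 / \<rho> i t) ||| 0) ;;
     (0 ||| - rowvector (u t) ||| 0 ||| 0 ||| - mat 1) ;;
     (0 ||| 0 ||| 0 ||| 0 ||| 0)"

definition sys_B :: "('n::finite \<Rightarrow> real^3) \<Rightarrow> (real \<Rightarrow> real^3^3) \<Rightarrow>
    ('n \<Rightarrow> real \<Rightarrow> real) \<Rightarrow> real \<Rightarrow> real^3^('n state_index)" where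
  "sys_B b R \<rho> t =
     transpose (- mat 1 ||| 0 ||| transpose (\<chi> i. (1 / \<rho> i t) *\<^sub>R (R t *v b i)) ||| 0 ||| 0)"

definition C_0 :: "real^('n::{finite, linorder})^('n::{finite, linorder})" where
  "C_0 = (\<chi> k. if k = Min UNIV then axis (Min UNIV) 1 else axis (Min UNIV) 1 - axis k 1)"

definition C_1 :: "('n::{card2, linorder} \<Rightarrow> real^3) \<Rightarrow> (real \<Rightarrow> real^3^3) \<Rightarrow>
    ('n \<Rightarrow> real \<Rightarrow> real) \<Rightarrow> real \<Rightarrow> real^3^('n receiver_pair)" where
  "C_1 b R \<rho> t = (\<chi> p. let (i, j) = Rep_receiver_pair p in
     (1 / (\<rho> i t + \<rho> j t)) *\<^sub>R ((2 *\<^sub>R (b i - b j)) v* transpose (R t)))"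

definition C_2 :: "real^('n::{card2, linorder})^('n receiver_pair)" where
  "C_2 = (\<chi> p. let (i, j) = Rep_receiver_pair p in axis i 1 - axis j 1)"

text \<open>The last block column of the mathematical definition, of width 2, appears as two columns of width 1.\<close>

definition sys_C :: "('n::{card2, linorder} \<Rightarrow> real^3) \<Rightarrow> (real \<Rightarrow> real^3^3) \<Rightarrow>
    ('n \<Rightarrow> real \<Rightarrow> real) \<Rightarrow> real \<Rightarrow> real^('n state_index)^('n + 'n receiver_pair)" where
  "sys_C b R \<rho> t =
     (0 ||| 0 ||| C_0 ||| 0 ||| 0) ;;
     (C_1 b R \<rho> t ||| 0 ||| C_2 ||| 0 ||| 0)"

definition range_system :: "('n::{card2, linorder} \<Rightarrow> real^3) \<Rightarrow> (real \<Rightarrow> real^3^3) \<Rightarrow>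
    (real \<Rightarrow> real^3) \<Rightarrow> (real \<Rightarrow> real^3) \<Rightarrow> ('n \<Rightarrow> real \<Rightarrow> real) \<Rightarrow>
    ('n state_index, 3, 'n + 'n receiver_pair) ltv_system" where
  "range_system b R \<omega> u \<rho> =
     \<lparr>state_mat = sys_A b R \<omega> u \<rho>, input_mat = sys_B b R \<rho>, output_mat = sys_C b R \<rho>\<rparr>"

end

(* Along a trajectory x = (x1, ..., x5) of the homogeneous system, x2 and x5 are constant, x1 is affine in
   time, x4 is affine up to the integral of u . x2, and rho_i times the derivative of x3_i equals -x4 plus a
   bounded linear function of (x1, x2). Explicit solutions therefore give the transition matrix. Over a unit
   window, a small output energy makes x3 small and, as the receivers are not coplanar, x1 small, hence also x1
   and x2 at the initial time. Differentiating the product rho_i x3_i, which moves the unknown signal rho_i away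
   from x4, shows that a quadratic polynomial in time with coefficients built from x3_i, x4, x5 at the initial
   time is small in L2, so these are small as well. All constants depend only on the bounds for the signals. *)

theory Submission
  imports Defs
begin

text \<open>The difficulty is uniformity in the initial time: the coefficients are bounded but need
  not recur, so each step has to be an inequality with one constant for all windows. The state
  starts at an arbitrary vector, hence x3 need not consist of ranges nor x1 be a position, and no
  identity between physical signals can be substituted for them. Moreover the output is small only
  in mean square, which says nothing about its derivative. So the differential relations are used in
  integrated form: \<rho>_i x3_i is a polynomial plus a remainder that starts at zero and whose
  derivative is small in mean. Without the factor \<rho>_i the coefficients to be recovered would
  enter divided by a varying function; with it the price is a term \<rho>_i' x3_i, which the bound
  on \<rho>_i' absorbs. The order of the estimates is forced: x2 feeds the derivatives of x3 and x4,
  so it has to be controlled before the polynomial can be isolated. On a window of length 1 the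
  moments of polynomials are plain fractions and the square of an integral is at most the integral
  of the square.\<close>

lemma bounded_bilinear_matrix_vector_mult:
  "bounded_bilinear ((*v) :: real^'n^'m \<Rightarrow> real^'n \<Rightarrow> real^'m)"
  unfolding bilinear_conv_bounded_bilinear[symmetric] bilinear_def
  by (auto intro!: linearI simp: algebra_simps scaleR_matrix_vector_assoc matrix_vector_mult_scaleR)

lemma bounded_bilinear_matrix_matrix_mult:
  "bounded_bilinear ((**) :: real^'n^'m \<Rightarrow> real^'k^'n \<Rightarrow> real^'k^'m)"
  unfolding bilinear_conv_bounded_bilinear[symmetric] bilinear_def
  by (auto intro!: linearI simp: matrix_matrix_mult_def vec_eq_iff algebra_simps sum.distrib sum_distrib_left)

lemma bounded_linear_transpose: "bounded_linear (transpose :: real^'n^'m \<Rightarrow> real^'m^'n)"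
  by (auto intro!: linearI simp: linear_conv_bounded_linear[symmetric] transpose_def vec_eq_iff)

section \<open>Linear differential equations\<close>

text \<open>Gronwall by an energy argument: the derivative of the squared norm is at most 2K times
  the squared norm, so the weighted energy \<open>f\<close> cannot increase.\<close>

lemma linear_ode_growth:
  fixes x :: "real \<Rightarrow> real^'n" and A :: "real \<Rightarrow> real^'n^'n"
  assumes "s \<le> T"
    and x: "\<And>t. t \<in> {s..T} \<Longrightarrow> (x has_vector_derivative A t *v x t) (at t within {s..T})"
    and A: "\<And>t z. t \<in> {s..T} \<Longrightarrow> norm (A t *v z) \<le> K * norm z"
  shows "norm (x T) \<le> exp (K * (T - s)) * norm (x s)"
proof -
  define f where "f t = exp (- (2 * K * (t - s))) * (x t \<bullet> x t)" for t
  have f: "(f has_real_derivative 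
      exp (- (2 * K * (t - s))) * (2 * (x t \<bullet> (A t *v x t)) - 2 * K * (x t \<bullet> x t))) (at t within {s..T})"
    if "t \<in> {s..T}" for t
  proof -
    have "((\<lambda>t. x t \<bullet> x t) has_vector_derivative x t \<bullet> (A t *v x t) + (A t *v x t) \<bullet> x t) (at t within {s..T})"
      by (rule bounded_bilinear.has_vector_derivative[OF bounded_bilinear_inner x[OF that] x[OF that]])
    then show ?thesis
      unfolding f_def has_real_derivative_iff_has_vector_derivative[symmetric]
      by (auto intro!: derivative_eq_intros simp: algebra_simps inner_commute)
  qed
  have "f T \<le> f s"
  proof (rule DERIV_nonpos_imp_decreasing_open[OF \<open>s \<le> T\<close>])
    show "continuous_on {s..T} f"
      using f by (meson DERIV_continuous continuous_on_eq_continuous_within)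
    show "\<exists>y. (f has_real_derivative y) (at t) \<and> y \<le> 0" if "s < t" "t < T" for t
    proof (intro exI conjI)
      show "(f has_real_derivative 
        exp (- (2 * K * (t - s))) * (2 * (x t \<bullet> (A t *v x t)) - 2 * K * (x t \<bullet> x t))) (at t)"
        using f[of t] that by (simp add: at_within_Icc_at)
      have "x t \<bullet> (A t *v x t) \<le> norm (x t) * norm (A t *v x t)"
        by (rule norm_cauchy_schwarz)
      also have "\<dots> \<le> norm (x t) * (K * norm (x t))"
        using A[of t] that by (intro mult_left_mono) auto
      also have "\<dots> = K * (x t \<bullet> x t)"
        by (simp add: dot_square_norm power2_eq_square)
      finally show "exp (- (2 * K * (t - s))) * (2 * (x t \<bullet> (A t *v x t)) - 2 * K * (x t \<bullet> x t)) \<le> 0"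
        by (intro mult_nonneg_nonpos) auto
    qed
  qed
  then have "exp (- (2 * K * (T - s))) * (norm (x T))\<^sup>2 \<le> (norm (x s))\<^sup>2"
    by (simp add: f_def dot_square_norm)
  then have "exp (2 * K * (T - s)) * (exp (- (2 * K * (T - s))) * (norm (x T))\<^sup>2)
      \<le> exp (2 * K * (T - s)) * (norm (x s))\<^sup>2"
    by (rule mult_left_mono) simp
  then have "(norm (x T))\<^sup>2 \<le> exp (2 * K * (T - s)) * (norm (x s))\<^sup>2"
    by (simp add: mult_exp_exp flip: mult.assoc)
  also have "\<dots> = (exp (K * (T - s)) * norm (x s))\<^sup>2"
    by (simp add: power_mult_distrib exp_double[symmetric] algebra_simps)
  finally show ?thesis
    by (rule power2_le_imp_le) simp
qed

lemma linear_ode_unique: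
  fixes x y :: "real \<Rightarrow> real^'n" and A :: "real \<Rightarrow> real^'n^'n"
  assumes "s \<le> T" "x s = y s"
    and x: "\<And>t. t \<in> {s..T} \<Longrightarrow> (x has_vector_derivative A t *v x t) (at t within {s..T})"
    and y: "\<And>t. t \<in> {s..T} \<Longrightarrow> (y has_vector_derivative A t *v y t) (at t within {s..T})"
    and A: "\<And>t z. t \<in> {s..T} \<Longrightarrow> norm (A t *v z) \<le> K * norm z"
  shows "x T = y T"
proof -
  have "norm (x T - y T) \<le> exp (K * (T - s)) * norm (x s - y s)"
    by (rule linear_ode_growth[where A = A, OF \<open>s \<le> T\<close> _ A])
      (auto intro!: has_vector_derivative_diff x y simp: matrix_vector_mult_diff_distrib)
  then show ?thesis using \<open>x s = y s\<close> by simp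
qed

lemma has_vector_derivative_vec_lambda:
  fixes f :: "'i::finite \<Rightarrow> real \<Rightarrow> 'a::euclidean_space"
  assumes "\<And>i. (f i has_vector_derivative f' i) (at t within S)"
  shows "((\<lambda>t. \<chi> i. f i t) has_vector_derivative (\<chi> i. f' i)) (at t within S)"
  unfolding has_vector_derivative_def
proof (subst has_derivative_componentwise_within, intro ballI)
  fix e :: "'a^'i" assume "e \<in> Basis"
  then obtain i d where e: "e = axis i d" "d \<in> Basis"
    by (auto simp: Basis_vec_def)
  show "((\<lambda>x. (\<chi> i. f i x) \<bullet> e) has_derivative (\<lambda>x. x *\<^sub>R (\<chi> i. f' i) \<bullet> e)) (at t within S)"
    using assms[of i] unfolding has_vector_derivative_def
    by (auto simp: e inner_axis intro!: derivative_eq_intros)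
qed

lemma has_vector_derivative_vec_nth:
  fixes f :: "real \<Rightarrow> 'a::euclidean_space^'i"
  assumes "(f has_vector_derivative f') F"
  shows "((\<lambda>t. f t $ i) has_vector_derivative f' $ i) F"
  by (rule bounded_linear.has_vector_derivative[OF bounded_linear_vec_nth assms])

text \<open>Gives access to the definite description in \<open>transition_matrix\<close>. Solutions
  for all initial values provide existence, column by column, and the growth estimate provides
  uniqueness. Linearity of \<open>S\<close> in \<open>c\<close> comes out of this
  comparison.\<close>

lemma transition_matrix_mult:
  fixes A :: "real \<Rightarrow> real^'n^'n" and S :: "real^'n \<Rightarrow> real \<Rightarrow> real^'n"
  assumes "s \<le> T" and init: "\<And>c. S c s = c"
    and S: "\<And>c t. t \<in> {s..T} \<Longrightarrow> (S c has_vector_derivative A t *v S c t) (at t within {s..T})"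
    and A: "\<And>t z. t \<in> {s..T} \<Longrightarrow> norm (A t *v z) \<le> K * norm z"
  shows "transition_matrix A T s *v c = S c T"
proof -
  \<comment> \<open>Used twice: it makes any two candidate matrices agree at \<open>T\<close> on
    every vector, and it evaluates the chosen one.\<close>
  have col: "X T *v c = S c T" if "X s = mat 1"
    "\<forall>t\<in>{s..T}. (X has_vector_derivative A t ** X t) (at t within {s..T})" for X c
  proof (rule linear_ode_unique[where x = "\<lambda>t. X t *v c" and A = A, OF \<open>s \<le> T\<close> _ _ S A])
    show "((\<lambda>t. X t *v c) has_vector_derivative A t *v (X t *v c)) (at t within {s..T})"
      if "t \<in> {s..T}" for t
      using bounded_linear.has_vector_derivative[OF
          bounded_bilinear.bounded_linear_left[OF bounded_bilinear_matrix_vector_mult, of c], of X]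
        that \<open>\<forall>t\<in>{s..T}. _\<close> by (auto simp: matrix_vector_mul_assoc)
  qed (simp_all add: init that)
  define X where "X t = (\<chi> k j. S (axis j 1) t $ k)" for t
  have X0: "X s = mat 1"
    by (auto simp: X_def init mat_def vec_eq_iff axis_def)
  have X1: "\<forall>t\<in>{s..T}. (X has_vector_derivative A t ** X t) (at t within {s..T})"
  proof
    fix t assume t: "t \<in> {s..T}"
    have "(X has_vector_derivative (\<chi> k j. (A t *v S (axis j 1) t) $ k)) (at t within {s..T})"
      unfolding X_def
      by (intro has_vector_derivative_vec_lambda has_vector_derivative_vec_nth S t)
    moreover have "(\<chi> k j. (A t *v S (axis j 1) t) $ k) = A t ** X t"
      by (simp add: X_def matrix_vector_mult_def matrix_matrix_mult_def vec_eq_iff)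
    ultimately show "(X has_vector_derivative A t ** X t) (at t within {s..T})" by simp
  qed
  have "transition_matrix A T s = X T"
    unfolding transition_matrix_def
  proof (rule the_equality)
    fix M assume "\<exists>Y. Y s = mat 1 \<and>
      (\<forall>t\<in>{s..T}. (Y has_vector_derivative A t ** Y t) (at t within {s..T})) \<and> Y T = M"
    then show "M = X T"
      using col X0 X1 by (metis matrix_eq)
  qed (use X0 X1 in blast)
  then show ?thesis using col[OF X0 X1] by simp
qed

lemma norm_matrix_vector_mult_bounded:
  fixes M :: "real \<Rightarrow> real^'n^'m"
  assumes "bounded (M ` S)"
  obtains K where "K > 0" "\<And>t z. t \<in> S \<Longrightarrow> norm (M t *v z) \<le> K * norm z"
proof -
  obtain B where B: "B > 0" "\<And>t. t \<in> S \<Longrightarrow> norm (M t) \<le> B"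
    using assms by (auto simp: bounded_pos)
  obtain L where L: "L > 0" "\<And>(M::real^'n^'m) z. norm (M *v z) \<le> norm M * norm z * L"
    using bounded_bilinear.pos_bounded[OF bounded_bilinear_matrix_vector_mult] by blast
  show ?thesis
  proof (rule that[of "B * L"])
    show "norm (M t *v z) \<le> B * L * norm z" if "t \<in> S" for t z
    proof -
      have "norm (M t *v z) \<le> norm (M t) * norm z * L" by (rule L(2))
      also have "\<dots> \<le> B * norm z * L"
        using B(2)[OF that] L(1) by (intro mult_right_mono) auto
      finally show ?thesis by (simp add: ac_simps)
    qed
  qed (use B L in auto)
qed

lemma inner_transpose_mult: "x \<bullet> (transpose M *v y) = (M *v x) \<bullet> (y::real^'m)" for M :: "real^'n^'m"
  by (metis dot_lmul_matrix inner_commute vector_transpose_matrix transpose_transpose)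

text \<open>The upper bound on the Gramian follows from boundedness alone, so only the lower bound remains
  to be checked on the trajectories.\<close>

lemma uniformly_completely_observableI:
  fixes sys :: "('n::finite, 'm::finite, 'p::finite) ltv_system"
    and S :: "real \<Rightarrow> real^'n \<Rightarrow> real \<Rightarrow> real^'n"
  assumes A: "bounded (state_mat sys ` {t0..})"
    and C: "bounded (output_mat sys ` {t0..})" "continuous_on {t0..} (output_mat sys)"
    and init: "\<And>t c. S t c t = c"
    and S: "\<And>t c \<tau> T. t0 \<le> t \<Longrightarrow> \<tau> \<in> {t..T} \<Longrightarrow>
      (S t c has_vector_derivative state_mat sys \<tau> *v S t c \<tau>) (at \<tau> within {t..T})"
    and pos: "\<alpha> > 0" "\<delta> > 0"
    and lower: "\<And>t c. t0 \<le> t \<Longrightarrow>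
      \<alpha> * (norm c)\<^sup>2 \<le> integral {t..t + \<delta>} (\<lambda>\<tau>. (norm (output_mat sys \<tau> *v S t c \<tau>))\<^sup>2)"
  shows "uniformly_completely_observable t0 sys"
proof -
  obtain K where K: "K > 0" "\<And>t z. t \<ge> t0 \<Longrightarrow> norm (state_mat sys t *v z) \<le> K * norm z"
    using norm_matrix_vector_mult_bounded[OF A] by (metis atLeast_iff)
  obtain L where L: "L > 0" "\<And>t z. t \<ge> t0 \<Longrightarrow> norm (output_mat sys t *v z) \<le> L * norm z"
    using norm_matrix_vector_mult_bounded[OF C(1)] by (metis atLeast_iff)
  \<comment> \<open>The state grows by at most \<open>exp (K * \<delta>)\<close> over the window and
    the output matrix contributes \<open>L\<close>; the squared bound is integrated over length
    \<delta>.\<close>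
  define \<beta> where "\<beta> = \<delta> * (L * exp (K * \<delta>))\<^sup>2"
  have "\<beta> > 0" using pos L by (simp add: \<beta>_def)
  have main: "\<alpha> *\<^sub>R mat 1 \<preceq>\<^sub>L observability_gramian sys t (t + \<delta>) \<and>
       observability_gramian sys t (t + \<delta>) \<preceq>\<^sub>L \<beta> *\<^sub>R mat 1" if t: "t \<ge> t0" for t
  proof -
    define \<Phi> where "\<Phi> \<tau> = transition_matrix (state_mat sys) \<tau> t" for \<tau>
    define D where "D = output_mat sys"
    define G where "G \<tau> = transpose (\<Phi> \<tau>) ** transpose (D \<tau>) ** D \<tau> ** \<Phi> \<tau>" for \<tau>
    have S': "(S t c has_vector_derivative state_mat sys \<tau> *v S t c \<tau>) (at \<tau> within {t..T})"
      if "\<tau> \<in> {t..T}" for \<tau> T c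
      using S[OF t that] .
    have \<Phi>: "\<Phi> \<tau> *v c = S t c \<tau>" if "t \<le> \<tau>" for \<tau> c
      unfolding \<Phi>_def
      by (rule transition_matrix_mult[where K = K]) (use that t K(2) in \<open>auto intro!: S' init\<close>)
    have S_cont: "continuous_on {t..t + \<delta>} (\<lambda>\<tau>. S t c \<tau>)" for c
      using S' has_vector_derivative_continuous continuous_on_eq_continuous_within by metis
    then have "continuous_on {t..t + \<delta>} (\<lambda>\<tau>. \<chi> k j. S t (axis j 1) \<tau> $ k)"
      by (intro continuous_intros)
    \<comment> \<open>\<open>transition_matrix\<close> is a separate definite description for each
      final time, so continuity in that time is read off from the columns, which are
      trajectories.\<close>
    moreover have "\<Phi> \<tau> = (\<chi> k j. S t (axis j 1) \<tau> $ k)" if "t \<le> \<tau>" for \<tau>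
      by (simp add: vec_eq_iff flip: \<Phi>[OF that] matrix_vector_mul_component)
         (simp add: matrix_vector_mult_basis column_def)
    ultimately have \<Phi>_cont: "continuous_on {t..t + \<delta>} \<Phi>"
      by (subst continuous_on_cong[OF refl]) auto
    have D_cont: "continuous_on {t..t + \<delta>} D"
      unfolding D_def by (rule continuous_on_subset[OF C(2)]) (use t in auto)
    note mm = bounded_bilinear.continuous_on[OF bounded_bilinear_matrix_matrix_mult]
      and tr = bounded_linear.continuous_on[OF bounded_linear_transpose]
    have "continuous_on {t..t + \<delta>} G"
      unfolding G_def by (intro mm tr \<Phi>_cont D_cont)
    then have int: "G integrable_on {t..t + \<delta>}"
      by (rule integrable_continuous_interval)
    have W: "observability_gramian sys t (t + \<delta>) = integral {t..t + \<delta>} G"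
      unfolding observability_gramian_def G_def \<Phi>_def D_def ..
    have "transpose (integral {t..t + \<delta>} G) = integral {t..t + \<delta>} (\<lambda>\<tau>. transpose (G \<tau>))"
      using integral_linear[OF int bounded_linear_transpose] by (simp add: o_def)
    also have "\<dots> = integral {t..t + \<delta>} G"
      by (rule integral_cong) (simp add: G_def matrix_transpose_mul matrix_mul_assoc)
    finally have sym: "transpose (integral {t..t + \<delta>} G) = integral {t..t + \<delta>} G" .
    \<comment> \<open>For fixed \<open>c\<close> the quadratic form is linear in the matrix and
      passes under the integral; this turns the Gramian into the output energy of the trajectory
      from \<open>c\<close>.\<close>
    have quad: "c \<bullet> (integral {t..t + \<delta>} G *v c) =
        integral {t..t + \<delta>} (\<lambda>\<tau>. (norm (D \<tau> *v S t c \<tau>))\<^sup>2)" for c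
    proof -
      have "bounded_linear (\<lambda>M. c \<bullet> (M *v c))"
        by (rule bounded_linear_compose[OF bounded_linear_inner_right
           bounded_bilinear.bounded_linear_left[OF bounded_bilinear_matrix_vector_mult]])
      from integral_linear[OF int this]
      have "c \<bullet> (integral {t..t + \<delta>} G *v c) = integral {t..t + \<delta>} (\<lambda>\<tau>. c \<bullet> (G \<tau> *v c))"
        by (simp add: o_def)
      also have "\<dots> = integral {t..t + \<delta>} (\<lambda>\<tau>. (norm (D \<tau> *v S t c \<tau>))\<^sup>2)"
        by (rule integral_cong)
          (simp add: G_def inner_transpose_mult dot_square_norm \<Phi> del: transpose_matrix_vector flip: matrix_vector_mul_assoc)
      finally show ?thesis .
    qed
    have upper: "integral {t..t + \<delta>} (\<lambda>\<tau>. (norm (D \<tau> *v S t c \<tau>))\<^sup>2) \<le> \<beta> * (norm c)\<^sup>2" for c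
    proof -
      have "integral {t..t + \<delta>} (\<lambda>\<tau>. (norm (D \<tau> *v S t c \<tau>))\<^sup>2)
          \<le> integral {t..t + \<delta>} (\<lambda>\<tau>. (L * exp (K * \<delta>) * norm c)\<^sup>2)"
      proof (rule integral_le)
        show "(\<lambda>\<tau>. (norm (D \<tau> *v S t c \<tau>))\<^sup>2) integrable_on {t..t + \<delta>}"
          by (intro integrable_continuous_interval continuous_intros
             bounded_bilinear.continuous_on[OF bounded_bilinear_matrix_vector_mult] D_cont S_cont)
        fix \<tau> assume \<tau>: "\<tau> \<in> {t..t + \<delta>}"
        have "norm (S t c \<tau>) \<le> exp (K * (\<tau> - t)) * norm (S t c t)"
          using \<tau> t K(2) by (intro linear_ode_growth[where A = "state_mat sys"] S') auto
        also have "\<dots> \<le> exp (K * \<delta>) * norm c"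
          using \<tau> K(1) by (auto simp: init intro!: mult_right_mono)
        finally have "norm (D \<tau> *v S t c \<tau>) \<le> L * (exp (K * \<delta>) * norm c)"
          using L(2)[of \<tau> "S t c \<tau>"] L(1) \<tau> t unfolding D_def
          by (smt (verit) atLeastAtMost_iff mult_left_mono)
        then show "(norm (D \<tau> *v S t c \<tau>))\<^sup>2 \<le> (L * exp (K * \<delta>) * norm c)\<^sup>2"
          by (simp add: power_mono mult.assoc)
      qed auto
      also have "\<dots> = \<beta> * (norm c)\<^sup>2"
        using pos by (simp add: \<beta>_def power_mult_distrib)
      finally show ?thesis .
    qed
    show ?thesis
      unfolding W loewner_le_def
      using sym lower[OF t] upper
      by (auto simp: transpose_scalar transpose_mat matrix_vector_mult_diff_rdistrib inner_diff_right quad D_def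
          dot_square_norm scaleR_matrix_vector_assoc[symmetric])
  qed
  show ?thesis
    unfolding uniformly_completely_observable_def
    using pos \<open>\<beta> > 0\<close> main by blast
qed

section \<open>Block vectors\<close>

text \<open>Vector counterpart of \<open>hcat\<close> and \<open>vcat\<close>: with it,
  \<open>hcat_mult_join\<close> and \<open>vcat_mult\<close> let the simplifier multiply block
  matrices block by block.\<close>

definition join :: "real^'a \<Rightarrow> real^'b \<Rightarrow> real^('a::finite + 'b::finite)" (infixr \<open>@@@\<close> 65) where
  "x @@@ y = (\<chi> k. case k of Inl a \<Rightarrow> x $ a | Inr b \<Rightarrow> y $ b)"

definition fstv :: "real^('a::finite + 'b::finite) \<Rightarrow> real^'a" where
  "fstv z = (\<chi> a. z $ Inl a)"

definition sndv :: "real^('a::finite + 'b::finite) \<Rightarrow> real^'b" where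
  "sndv z = (\<chi> b. z $ Inr b)"

lemma fstv_join [simp]: "fstv (x @@@ y) = x" and sndv_join [simp]: "sndv (x @@@ y) = y"
  by (simp_all add: fstv_def sndv_def join_def)

lemma join_nth [simp]: "(x @@@ y) $ Inl a = x $ a" "(x @@@ y) $ Inr b = y $ b"
  by (simp_all add: join_def)

lemma join_fstv_sndv [simp]: "fstv z @@@ sndv z = z"
  by (auto simp: fstv_def sndv_def join_def vec_eq_iff split: sum.split)

lemma sum_UNIV_Plus:
  "(\<Sum>k\<in>(UNIV :: ('a::finite + 'b::finite) set). f k) = (\<Sum>a\<in>UNIV. f (Inl a)) + (\<Sum>b\<in>UNIV. f (Inr b))"
  by (simp add: UNIV_Plus_UNIV[symmetric] sum.Plus del: UNIV_Plus_UNIV)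

lemma norm_join_power2: "(norm (x @@@ y))\<^sup>2 = (norm x)\<^sup>2 + (norm y)\<^sup>2"
  by (simp add: power2_norm_eq_inner inner_vec_def sum_UNIV_Plus)

lemma hcat_mult_join [simp]: "(P ||| Q) *v (x @@@ y) = P *v x + Q *v y"
  by (simp add: matrix_vector_mult_def hcat_def vec_eq_iff sum_UNIV_Plus)

lemma vcat_mult [simp]: "(P ;; Q) *v z = (P *v z) @@@ (Q *v z)"
  by (auto simp: matrix_vector_mult_def vcat_def join_def vec_eq_iff split: sum.split)

lemma has_vector_derivative_join:
  assumes "(f has_vector_derivative f') (at t within S)" "(g has_vector_derivative g') (at t within S)"
  shows "((\<lambda>t. f t @@@ g t) has_vector_derivative f' @@@ g') (at t within S)"
  unfolding join_def
  by (rule has_vector_derivative_vec_lambda)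
    (auto split: sum.split intro!: has_vector_derivative_vec_nth assms)

section \<open>Bounded continuous signals\<close>

text \<open>Continuity makes the Gramian integrand integrable, and boundedness gives constants that
  are uniform in time. Both survive the same operations, so one set of introduction rules settles
  the system matrices.\<close>

definition bdd_cont_on :: "real set \<Rightarrow> (real \<Rightarrow> 'a::real_normed_vector) \<Rightarrow> bool" where
  "bdd_cont_on S f \<longleftrightarrow> continuous_on S f \<and> bounded (f ` S)"

lemma bdd_cont_on_bounded: 
  assumes "bdd_cont_on S f"
  obtains M where "M > 0" "\<And>t. t \<in> S \<Longrightarrow> norm (f t) \<le> M"
  using assms by (auto simp: bdd_cont_on_def bounded_pos)

lemma bdd_cont_on_const: "bdd_cont_on S (\<lambda>t. c)"
  by (auto simp: bdd_cont_on_def image_constant_conv)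

lemma bdd_cont_on_add: "bdd_cont_on S f \<Longrightarrow> bdd_cont_on S g \<Longrightarrow> bdd_cont_on S (\<lambda>t. f t + g t)"
  by (auto simp: bdd_cont_on_def intro: continuous_intros bounded_plus_comp)

lemma bdd_cont_on_diff: "bdd_cont_on S f \<Longrightarrow> bdd_cont_on S g \<Longrightarrow> bdd_cont_on S (\<lambda>t. f t - g t)"
  by (auto simp: bdd_cont_on_def intro: continuous_intros bounded_minus_comp)

lemma bdd_cont_on_bilinear:
  assumes "bounded_bilinear h" "bdd_cont_on S f" "bdd_cont_on S g"
  shows "bdd_cont_on S (\<lambda>t. h (f t) (g t))"
proof -
  obtain K where K: "K > 0" "\<And>x y. norm (h x y) \<le> norm x * norm y * K"
    using bounded_bilinear.pos_bounded[OF assms(1)] by blast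
  obtain F where F: "F > 0" "\<And>t. t \<in> S \<Longrightarrow> norm (f t) \<le> F"
    using bdd_cont_on_bounded[OF assms(2)] by blast
  obtain G where G: "G > 0" "\<And>t. t \<in> S \<Longrightarrow> norm (g t) \<le> G"
    using bdd_cont_on_bounded[OF assms(3)] by blast
  have "norm (h (f t) (g t)) \<le> F * G * K" if "t \<in> S" for t
    using F G K that by (intro order.trans[OF K(2)] mult_mono) auto
  then have "bounded ((\<lambda>t. h (f t) (g t)) ` S)"
    by (auto simp: bounded_iff)
  then show ?thesis
    using assms by (auto simp: bdd_cont_on_def intro: bounded_bilinear.continuous_on)
qed

lemma bdd_cont_on_linear:
  assumes "bounded_linear h" "bdd_cont_on S f"
  shows "bdd_cont_on S (\<lambda>t. h (f t))"
  using assms bounded_linear_image[of "f ` S" h]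
  by (auto simp: bdd_cont_on_def image_image intro: bounded_linear.continuous_on)

lemma bdd_cont_on_vec_lambda:
  fixes f :: "'i::finite \<Rightarrow> real \<Rightarrow> 'a::real_normed_vector"
  assumes "\<And>i. bdd_cont_on S (f i)"
  shows "bdd_cont_on S (\<lambda>t. \<chi> i. f i t)"
proof -
  have "\<forall>i. \<exists>B. \<forall>t\<in>S. norm (f i t) \<le> B"
    using bdd_cont_on_bounded[OF assms] by metis
  then obtain B where B: "\<And>i t. t \<in> S \<Longrightarrow> norm (f i t) \<le> B i"
    by metis
  have "norm (\<chi> i. f i t) \<le> (\<Sum>i\<in>UNIV. B i)" if "t \<in> S" for t
    unfolding norm_vec_def
    by (rule order.trans[OF L2_set_le_sum]) (auto intro!: sum_mono B that)
  then have "bounded ((\<lambda>t. \<chi> i. f i t) ` S)"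
    by (auto simp: bounded_iff)
  then show ?thesis
    using assms by (auto simp: bdd_cont_on_def intro: continuous_on_vec_lambda)
qed

lemma bdd_cont_on_reciprocal:
  fixes f :: "real \<Rightarrow> real"
  assumes "continuous_on S f" "m > 0" "\<And>t. t \<in> S \<Longrightarrow> m \<le> f t"
  shows "bdd_cont_on S (\<lambda>t. 1 / f t)"
proof -
  have "norm (1 / f t) \<le> 1 / m" if "t \<in> S" for t
    using assms(3)[OF that] assms(2) by (simp add: frac_le)
  then have "bounded ((\<lambda>t. 1 / f t) ` S)"
    by (auto simp: bounded_iff)
  moreover have "continuous_on S (\<lambda>t. 1 / f t)"
    using assms by (intro continuous_intros) (auto, smt (verit))
  ultimately show ?thesis by (simp add: bdd_cont_on_def)
qed

lemma bdd_cont_on_hcat: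
  assumes "bdd_cont_on S P" "bdd_cont_on S Q"
  shows "bdd_cont_on S (\<lambda>t. P t ||| Q t)"
  unfolding hcat_def using assms
  by (intro bdd_cont_on_vec_lambda, case_tac ia)
    (auto intro!: bdd_cont_on_linear[OF bounded_linear_vec_nth])

lemma bdd_cont_on_vcat:
  assumes "bdd_cont_on S P" "bdd_cont_on S Q"
  shows "bdd_cont_on S (\<lambda>t. P t ;; Q t)"
  unfolding vcat_def using assms
  by (intro bdd_cont_on_vec_lambda, case_tac i)
    (auto intro!: bdd_cont_on_linear[OF bounded_linear_vec_nth])

lemma bounded_bilinear_vector_matrix_mult:
  "bounded_bilinear ((v*) :: real^'m \<Rightarrow> real^'n^'m \<Rightarrow> real^'n)"
  unfolding bilinear_conv_bounded_bilinear[symmetric] bilinear_def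
  by (auto intro!: linearI simp: vector_matrix_mult_def vec_eq_iff algebra_simps sum.distrib sum_distrib_left)

lemma bounded_linear_rowvector: "bounded_linear (rowvector :: real^'n \<Rightarrow> real^'n^1)"
  by (auto intro!: linearI simp: linear_conv_bounded_linear[symmetric] rowvector_def vec_eq_iff)

lemma rowvector_mult: "rowvector x *v y = (\<chi> i. x \<bullet> (y :: real^'n))"
  by (simp add: rowvector_def matrix_vector_mult_def inner_vec_def vec_eq_iff)

lemma skew_mult: "skew w *v z = cross3 w z"
proof -
  have "linear (cross3 w)" by (intro linearI) (auto simp: cross_add_right cross_mult_right)
  then show ?thesis unfolding skew_def by (simp add: matrix_works)
qed

lemma bounded_linear_skew: "bounded_linear skew"
  unfolding linear_conv_bounded_linear[symmetric]
  by (rule linearI)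
    (simp_all add: matrix_eq skew_mult cross_add_left cross_mult_left matrix_vector_mult_add_rdistrib
      flip: scaleR_matrix_vector_assoc)

lemmas bdd_cont_on_intros =
  bdd_cont_on_const bdd_cont_on_add bdd_cont_on_diff
  bdd_cont_on_linear[OF bounded_linear_minus[OF bounded_linear_ident]]
  bdd_cont_on_linear[OF bounded_linear_skew] bdd_cont_on_linear[OF bounded_linear_rowvector]
  bdd_cont_on_linear[OF bounded_linear_transpose]
  bdd_cont_on_bilinear[OF bounded_bilinear_scaleR] bdd_cont_on_bilinear[OF bounded_bilinear_matrix_matrix_mult]
  bdd_cont_on_bilinear[OF bounded_bilinear_vector_matrix_mult]
  bdd_cont_on_vec_lambda bdd_cont_on_hcat bdd_cont_on_vcat

section \<open>Elementary lower bounds\<close>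

text \<open>An affine basis of a plane in dimension 3 has exactly three points, and these are the
  witnesses that \<open>coplanar\<close> asks for.\<close>

lemma hyperplane_coplanar:
  fixes z :: "real^3"
  assumes "z \<noteq> 0"
  shows "coplanar {x. z \<bullet> x = d}"
proof -
  obtain B where B: "\<not> affine_dependent B" "affine hull B = affine hull {x. z \<bullet> x = d}"
    using affine_basis_exists by metis
  have "aff_dim B = 2"
    using B(2) aff_dim_hyperplane[OF assms, of d] aff_dim_affine_hull[of B]
      aff_dim_affine_hull[of "{x. z \<bullet> x = d}"] by simp
  then have "int (card B) = 3"
    using aff_dim_affine_independent[OF B(1)] by simp
  then have "card B = 3" by simp
  then obtain u v w where "B = {u, v, w}"
    by (auto simp: card_3_iff)
  then have "{x. z \<bullet> x = d} \<subseteq> affine hull {u, v, w}"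
    using hull_subset[of "{x. z \<bullet> x = d}" affine] B(2) by simp
  then show ?thesis
    unfolding coplanar_def by blast
qed

text \<open>A nonzero \<open>z\<close> orthogonal to all differences would be the normal of a plane
  through all receivers. So the linear map \<open>T\<close> is injective, and in finite dimension it
  is then bounded below.\<close>

lemma noncoplanar_norm_bound:
  fixes b :: "'n::finite \<Rightarrow> real^3"
  assumes "\<not> coplanar (range b)"
  obtains K where "K > 0" "\<And>z m. (\<And>i j. \<bar>(b i - b j) \<bullet> z\<bar> \<le> m) \<Longrightarrow> norm z \<le> K * m"
proof -
  define T :: "real^3 \<Rightarrow> real^('n \<times> 'n)" where "T z = (\<chi> p. (b (fst p) - b (snd p)) \<bullet> z)" for z
  have lin: "linear T"
    by (auto intro!: linearI simp: T_def vec_eq_iff inner_add_right)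
  have "inj T"
  proof (subst linear_injective_0[OF lin], intro allI impI, rule ccontr)
    fix z assume "T z = 0" "z \<noteq> 0"
    then have "z \<bullet> b i = z \<bullet> b j" for i j
      by (simp add: T_def vec_eq_iff inner_diff_left inner_commute[of z])
    then have "range b \<subseteq> {x. z \<bullet> x = z \<bullet> b undefined}" by blast
    with hyperplane_coplanar[OF \<open>z \<noteq> 0\<close>] assms show False
      unfolding coplanar_def by (meson order.trans)
  qed
  from linear_inj_bounded_below_pos[OF lin this]
  obtain B where B: "B > 0" "\<And>z. B * norm z \<le> norm (T z)" by blast
  \<comment> \<open>The number of index pairs: the norm of \<open>T z\<close> is estimated by the
    sum of its components, each at most \<open>m\<close>.\<close>
  define N where "N = real (CARD('n \<times> 'n))"
  show ?thesis
  proof (rule that[of "N / B"])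
    show "0 < N / B" using B(1) unfolding N_def by (simp del: card_prod)
    fix z m assume "\<And>i j. \<bar>(b i - b j) \<bullet> z\<bar> \<le> m"
    then have "norm (T z) \<le> (\<Sum>p\<in>(UNIV::('n\<times>'n) set). m)"
      by (intro order.trans[OF norm_le_l1_cart] sum_mono) (simp add: T_def)
    then show "norm z \<le> N / B * m"
      using B(2)[of z] B(1) by (simp add: N_def field_simps)
  qed
qed

text \<open>Degree four because it serves to integrate the square of a quadratic; affine functions
  use it with vanishing top coefficients.\<close>

lemma has_integral_quartic:
  fixes a0 a1 a2 a3 a4 t :: real
  shows "((\<lambda>\<tau>. a0 + (\<tau> - t) * a1 + (\<tau> - t)\<^sup>2 * a2 + (\<tau> - t) ^ 3 * a3 + (\<tau> - t) ^ 4 * a4) has_integral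
    a0 + a1 / 2 + a2 / 3 + a3 / 4 + a4 / 5) {t..t + 1}"
proof -
  define F where "F \<tau> = (\<tau> - t) * a0 + (\<tau> - t) ^ 2 * (a1 / 2) + (\<tau> - t) ^ 3 * (a2 / 3) + (\<tau> - t) ^ 4 * (a3 / 4)
    + (\<tau> - t) ^ 5 * (a4 / 5)" for \<tau>
  have "((\<lambda>\<tau>. a0 + (\<tau> - t) * a1 + (\<tau> - t)\<^sup>2 * a2 + (\<tau> - t) ^ 3 * a3 + (\<tau> - t) ^ 4 * a4) has_integral
    F (t + 1) - F t) {t..t + 1}"
    unfolding F_def
    by (rule fundamental_theorem_of_calculus)
      (auto intro!: derivative_eq_intros simp flip: has_real_derivative_iff_has_vector_derivative)
  then show ?thesis by (simp add: F_def)
qed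

text \<open>The energy is the positive definite form |p|^2 - p.q + |q|^2 / 3, and each bound
  completes the square in the other vector.\<close>

lemma affine_L2_lower_bound:
  fixes p q :: "'a::real_inner"
  assumes "((\<lambda>\<tau>. (norm (p - (\<tau> - t) *\<^sub>R q))\<^sup>2) has_integral I) {t..t + 1}"
  shows "(norm p)\<^sup>2 \<le> 8 * I" "(norm q)\<^sup>2 \<le> 12 * I"
proof -
  have "(norm (p - (\<tau> - t) *\<^sub>R q))\<^sup>2 =
      p \<bullet> p + (\<tau> - t) * (- 2 * (p \<bullet> q)) + (\<tau> - t)\<^sup>2 * (q \<bullet> q) + (\<tau> - t) ^ 3 * 0 + (\<tau> - t) ^ 4 * 0" for \<tau>
    unfolding power2_norm_eq_inner by (simp add: inner_diff inner_commute algebra_simps power2_eq_square)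
  then have I: "I = p \<bullet> p - p \<bullet> q + (q \<bullet> q) / 3"
    using has_integral_unique[OF assms] has_integral_quartic[of "p \<bullet> p" t "- 2 * (p \<bullet> q)" "q \<bullet> q" 0 0] by simp
  have 1: "I = (p - (1/2) *\<^sub>R q) \<bullet> (p - (1/2) *\<^sub>R q) + (q \<bullet> q) / 12"
    unfolding I by (simp add: algebra_simps inner_commute)
  \<comment> \<open>Chosen so that 8 I - |p|^2 equals |7p - 4q|^2 / 7 + 8 |q|^2 / 21.\<close>
  have 2: "(7 *\<^sub>R p - 4 *\<^sub>R q) \<bullet> (7 *\<^sub>R p - 4 *\<^sub>R q) = 49 * (p \<bullet> p) - 56 * (p \<bullet> q) + 16 * (q \<bullet> q)"
    by (simp add: algebra_simps inner_commute)
  have "0 \<le> (p - (1/2) *\<^sub>R q) \<bullet> (p - (1/2) *\<^sub>R q)" "0 \<le> q \<bullet> q"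
    "0 \<le> (7 *\<^sub>R p - 4 *\<^sub>R q) \<bullet> (7 *\<^sub>R p - 4 *\<^sub>R q)" by (simp_all only: inner_ge_zero)
  with I 1 2 show "(norm p)\<^sup>2 \<le> 8 * I" "(norm q)\<^sup>2 \<le> 12 * I"
    unfolding power2_norm_eq_inner by linarith+
qed

text \<open>The shifted Legendre polynomials diagonalise the energy of a quadratic on a unit
  interval. The constant 1000 is a generous common bound: the steps yield 351, 384 and 180.\<close>

lemma quadratic_L2_lower_bound:
  fixes a b c :: real
  assumes "((\<lambda>\<tau>. (a + (\<tau> - t) * b + (\<tau> - t)\<^sup>2 * c)\<^sup>2) has_integral I) {t..t + 1}"
  shows "a\<^sup>2 \<le> 1000 * I" "b\<^sup>2 \<le> 1000 * I" "c\<^sup>2 \<le> 1000 * I"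
proof -
  have "(a + (\<tau> - t) * b + (\<tau> - t)\<^sup>2 * c)\<^sup>2 = a\<^sup>2 + (\<tau> - t) * (2 * a * b) + (\<tau> - t)\<^sup>2 * (b\<^sup>2 + 2 * a * c)
      + (\<tau> - t) ^ 3 * (2 * b * c) + (\<tau> - t) ^ 4 * c\<^sup>2" for \<tau>
    by algebra
  then have I: "I = a\<^sup>2 + a * b + (b\<^sup>2 + 2 * a * c) / 3 + b * c / 2 + c\<^sup>2 / 5"
    using has_integral_unique[OF assms] has_integral_quartic[of "a\<^sup>2" t "2 * a * b" "b\<^sup>2 + 2 * a * c" "2 * b * c" "c\<^sup>2"]
    by simp
  \<comment> \<open>With s the elapsed time, a + b s + c s^2 = A + B (s - 1/2) + c (s^2 - s + 1/6).
    The three polynomials are orthogonal with squared norms 1, 1/12 and 1/180.\<close>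
  define A where "A = a + b / 2 + c / 3"
  define B where "B = b + c"
  have sos: "I = A\<^sup>2 + B\<^sup>2 / 12 + c\<^sup>2 / 180"
    unfolding I A_def B_def by (simp add: power2_eq_square field_simps)
  have nonneg: "0 \<le> A\<^sup>2" "0 \<le> B\<^sup>2" "0 \<le> c\<^sup>2" by simp_all
  then have bds: "A\<^sup>2 \<le> I" "B\<^sup>2 \<le> 12 * I" "c\<^sup>2 \<le> 180 * I"
    using sos by linarith+
  then show "c\<^sup>2 \<le> 1000 * I" using nonneg by linarith
  have "2 * B\<^sup>2 + 2 * c\<^sup>2 - b\<^sup>2 = (B + c)\<^sup>2"
    unfolding B_def by (simp add: power2_eq_square algebra_simps)
  then have b: "b\<^sup>2 \<le> 2 * B\<^sup>2 + 2 * c\<^sup>2"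
    by (metis diff_ge_0_iff_ge zero_le_power2)
  then show "b\<^sup>2 \<le> 1000 * I" using bds nonneg by linarith
  \<comment> \<open>The square of the three-term sum a = A - b/2 - c/3 is at most three times the
    sum of the squares; the defect is the sum of the squared pairwise differences.\<close>
  have "3 * A\<^sup>2 + 3/4 * b\<^sup>2 + 1/3 * c\<^sup>2 - a\<^sup>2 = (A + b / 2)\<^sup>2 + (A + c / 3)\<^sup>2 + (b / 2 - c / 3)\<^sup>2"
    unfolding A_def by (simp add: power2_eq_square algebra_simps)
  then have "a\<^sup>2 \<le> 3 * A\<^sup>2 + 3/4 * b\<^sup>2 + 1/3 * c\<^sup>2"
    by (smt (verit) zero_le_power2)
  then show "a\<^sup>2 \<le> 1000 * I" using bds nonneg b by linarith
qed

text \<open>On a unit interval the integral \<open>m\<close> is the mean of \<open>f\<close>, and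
  the difference of the two sides is the variance, the integral of (f - m)^2.\<close>

lemma integral_power2_le:
  fixes f :: "real \<Rightarrow> real"
  assumes "continuous_on {t..t + 1} f"
  shows "(integral {t..t + 1} f)\<^sup>2 \<le> integral {t..t + 1} (\<lambda>\<tau>. (f \<tau>)\<^sup>2)"
proof -
  define m where "m = integral {t..t + 1} f"
  have 1: "(f has_integral m) {t..t + 1}"
    unfolding m_def by (intro integrable_integral integrable_continuous_interval assms)
  have 2: "((\<lambda>\<tau>. (f \<tau>)\<^sup>2) has_integral integral {t..t + 1} (\<lambda>\<tau>. (f \<tau>)\<^sup>2)) {t..t + 1}"
    by (intro integrable_integral integrable_continuous_interval continuous_intros assms)
  have "((\<lambda>\<tau>. (f \<tau>)\<^sup>2 - 2 * m * f \<tau> + m\<^sup>2) has_integral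
      integral {t..t + 1} (\<lambda>\<tau>. (f \<tau>)\<^sup>2) - 2 * m * m + m\<^sup>2) {t..t + 1}"
    using has_integral_const_real[of "m\<^sup>2" t "t + 1"]
    by (intro has_integral_add has_integral_diff 2 has_integral_mult_right 1) simp
  moreover have "0 \<le> (f \<tau>)\<^sup>2 - 2 * m * f \<tau> + m\<^sup>2" for \<tau>
    using zero_le_power2[of "f \<tau> - m"] by (simp add: power2_eq_square algebra_simps)
  ultimately have "0 \<le> integral {t..t + 1} (\<lambda>\<tau>. (f \<tau>)\<^sup>2) - 2 * m * m + m\<^sup>2"
    by (rule has_integral_nonneg)
  then show ?thesis by (simp add: m_def power2_eq_square)
qed

section \<open>The blocks of the navigation system\<close>

lemma join_eq_iff [simp]: "x @@@ y = x' @@@ y' \<longleftrightarrow> x = x' \<and> y = y'"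
  by (metis fstv_join sndv_join)

lemma uminus_matrix_vector_mult: "(- A) *v x = - (A *v (x :: real^'n))"
  by (metis diff_0 matrix_vector_mult_0 matrix_vector_mult_diff_rdistrib)

lemma matrix_rows_mult: "(\<chi> i. r i) *v x = (\<chi> i. r i \<bullet> (x :: real^'n))"
  by (simp add: matrix_vector_mult_def inner_vec_def vec_eq_iff)

text \<open>Row \<open>i\<close> of the third block of \<open>sys_A\<close> applied to a state,
  multiplied by \<rho>_i and without the x4 term: the part that x1 and x2 alone control.\<close>

definition range_drift ::
    "('n::finite \<Rightarrow> real^3) \<Rightarrow> (real \<Rightarrow> real^3^3) \<Rightarrow> (real \<Rightarrow> real^3) \<Rightarrow> (real \<Rightarrow> real^3) \<Rightarrow>
     'n \<Rightarrow> real \<Rightarrow> real^3 \<Rightarrow> real^3 \<Rightarrow> real" where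
  "range_drift b R \<omega> u i t p q =
     b i \<bullet> (skew (\<omega> t) *v (transpose (R t) *v p)) - u t \<bullet> p + b i \<bullet> (transpose (R t) *v q)"

lemma sys_A_mult:
  "sys_A b R \<omega> u \<rho> t *v (x1 @@@ x2 @@@ x3 @@@ x4 @@@ x5) =
     (- x2) @@@ 0 @@@ (\<chi> i. (1 / \<rho> i t) * (range_drift b R \<omega> u i t x1 x2 - x4 $ 1)) @@@
     (- (\<chi> _. u t \<bullet> x2) - x5) @@@ 0"
proof -
  have "(\<chi> j. - 1 / r) \<bullet> x4 = - (x4 $ 1) / r" for r :: real
    by (simp add: inner_vec_def UNIV_1)
  then show ?thesis
    by (simp add: sys_A_def uminus_matrix_vector_mult rowvector_mult matrix_rows_mult inner_diff_left dot_lmul_matrix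
        range_drift_def del: transpose_matrix_vector vector_transpose_matrix flip: matrix_vector_mul_assoc)
      (simp add: vec_eq_iff algebra_simps add_divide_distrib diff_divide_distrib)
qed

lemma sys_C_mult:
  "sys_C b R \<rho> t *v (x1 @@@ x2 @@@ x3 @@@ x4 @@@ x5) =
     (\<chi> k. if k = Min UNIV then x3 $ Min UNIV else x3 $ Min UNIV - x3 $ k) @@@
     (\<chi> p. let (i, j) = Rep_receiver_pair p in
        2 / (\<rho> i t + \<rho> j t) * ((b i - b j) \<bullet> (transpose (R t) *v x1)) + (x3 $ i - x3 $ j))"
  by (simp add: sys_C_def C_0_def C_1_def C_2_def matrix_rows_mult Let_def split_beta inner_diff_left
      dot_lmul_matrix del: transpose_matrix_vector vector_transpose_matrix)
    (simp add: vec_eq_iff fun_eq_iff inner_diff_left inner_axis' algebra_simps)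

section \<open>The known signals and their bounds\<close>

locale range_signals =
  fixes b :: "'n::{card2, linorder} \<Rightarrow> real^3"
    and R :: "real \<Rightarrow> real^3^3" and \<omega> u :: "real \<Rightarrow> real^3"
    and \<rho> \<rho>' :: "'n \<Rightarrow> real \<Rightarrow> real"
    and t0 Rmin Rmax :: real
  assumes R_orthogonal: "\<And>t. t0 \<le> t \<Longrightarrow> orthogonal_matrix (R t)"
    and R_cont: "continuous_on {t0..} R"
    and \<omega>: "bdd_cont_on {t0..} \<omega>"
    and u: "bdd_cont_on {t0..} u"
    and noncoplanar: "\<not> coplanar (range b)"
    and Rmin_pos: "0 < Rmin"
    and \<rho>_bounds: "\<And>i t. t0 \<le> t \<Longrightarrow> Rmin \<le> \<rho> i t \<and> \<rho> i t \<le> Rmax"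
    and \<rho>_deriv: "\<And>i t. t0 \<le> t \<Longrightarrow> (\<rho> i has_real_derivative \<rho>' i t) (at t within {t0..})"
    and \<rho>'_bounded: "\<And>i. bounded (\<rho>' i ` {t0..})"
begin

lemma \<rho>_cont: "continuous_on {t0..} (\<rho> i)"
  using \<rho>_deriv by (meson DERIV_continuous atLeast_iff continuous_on_eq_continuous_within)

lemma \<rho>_pos: "t0 \<le> t \<Longrightarrow> 0 < \<rho> i t"
  using \<rho>_bounds[of t i] Rmin_pos by linarith

lemma Rmax_pos: "0 < Rmax"
  using \<rho>_bounds[of t0 undefined] Rmin_pos by linarith

lemma norm_transpose_R: "t0 \<le> t \<Longrightarrow> norm (transpose (R t) *v p) = norm p"
  unfolding norm_eq_sqrt_inner inner_transpose_mult matrix_vector_mul_assoc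
  using R_orthogonal[of t] by (simp add: orthogonal_matrix_def)

lemma R_bdd: "bdd_cont_on {t0..} R"
proof -
  have "norm (R t) \<le> 3" if "t0 \<le> t" for t
  proof -
    have "norm (R t $ i) = 1" for i
      using R_orthogonal[OF that] by (simp add: orthogonal_matrix_orthonormal_rows row_def)
    then have "norm (R t) \<le> (\<Sum>i\<in>(UNIV::3 set). 1)"
      unfolding norm_vec_def[of "R t"] by (intro order.trans[OF L2_set_le_sum]) auto
    then show ?thesis by simp
  qed
  then have "bounded (R ` {t0..})" by (auto simp: bounded_iff)
  then show ?thesis using R_cont by (simp add: bdd_cont_on_def)
qed

lemma reciprocal_\<rho>: "bdd_cont_on {t0..} (\<lambda>t. 1 / \<rho> i t)"
  by (rule bdd_cont_on_reciprocal[OF \<rho>_cont Rmin_pos]) (use \<rho>_bounds in auto)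

lemma reciprocal_\<rho>_add: "bdd_cont_on {t0..} (\<lambda>t. 1 / (\<rho> i t + \<rho> j t))"
proof (rule bdd_cont_on_reciprocal[OF continuous_on_add[OF \<rho>_cont \<rho>_cont] Rmin_pos])
  show "Rmin \<le> \<rho> i t + \<rho> j t" if "t \<in> {t0..}" for t
    using \<rho>_bounds[of t i] \<rho>_pos[of t j] that by auto
qed

lemma sys_A_bdd: "bdd_cont_on {t0..} (sys_A b R \<omega> u \<rho>)"
proof -
  have "bdd_cont_on {t0..} (\<lambda>t. - 1 / \<rho> i t)" for i
    using bdd_cont_on_linear[OF bounded_linear_minus[OF bounded_linear_ident] reciprocal_\<rho>] by simp
  then show ?thesis
    unfolding sys_A_def[abs_def] by (intro bdd_cont_on_intros R_bdd \<omega> u reciprocal_\<rho>)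
qed

lemma sys_C_bdd: "bdd_cont_on {t0..} (sys_C b R \<rho>)"
  unfolding sys_C_def[abs_def] C_1_def Let_def split_beta
  by (intro bdd_cont_on_intros R_bdd reciprocal_\<rho>_add)

section \<open>Explicit trajectories of the homogeneous system\<close>

definition pos :: "real \<Rightarrow> real^3 \<Rightarrow> real^3 \<Rightarrow> real \<Rightarrow> real^3" where
  "pos t p q \<tau> = p - (\<tau> - t) *\<^sub>R q"

definition fourth_block :: "real \<Rightarrow> real^3 \<Rightarrow> real^1 \<Rightarrow> real^1 \<Rightarrow> real \<Rightarrow> real^1" where
  "fourth_block t q a e \<tau> = a - (\<tau> - t) *\<^sub>R e - (\<chi> _. integral {t..\<tau>} u \<bullet> q)"

definition range_rate :: "real \<Rightarrow> real^3 \<Rightarrow> real^3 \<Rightarrow> real^1 \<Rightarrow> real^1 \<Rightarrow> 'n \<Rightarrow> real \<Rightarrow> real" where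
  "range_rate t p q a e i \<tau> = (1 / \<rho> i \<tau>) * (range_drift b R \<omega> u i \<tau> (pos t p q \<tau>) q - fourth_block t q a e \<tau> $ 1)"

definition ranges :: "real \<Rightarrow> real^3 \<Rightarrow> real^3 \<Rightarrow> (real, 'n) vec \<Rightarrow> real^1 \<Rightarrow> real^1 \<Rightarrow> real \<Rightarrow> (real, 'n) vec" where
  "ranges t p q d a e \<tau> = (\<chi> i. d $ i + integral {t..\<tau>} (range_rate t p q a e i))"

text \<open>The third block column of \<open>sys_A\<close> vanishes, and the derivative of every
  block involves only blocks that are already explicit, so successive integration solves the system.
  The arguments \<open>p q d a e\<close> are the blocks of the state at time
  \<open>t\<close>.\<close>

definition trajectory :: "real \<Rightarrow> real^3 \<Rightarrow> real^3 \<Rightarrow> (real, 'n) vec \<Rightarrow> real^1 \<Rightarrow> real^1 \<Rightarrow> real \<Rightarrow> real^'n state_index" where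
  "trajectory t p q d a e \<tau> = pos t p q \<tau> @@@ q @@@ ranges t p q d a e \<tau> @@@ fourth_block t q a e \<tau> @@@ e"

lemma trajectory_init: "trajectory t p q d a e t = p @@@ q @@@ d @@@ a @@@ e"
  by (simp add: trajectory_def pos_def fourth_block_def ranges_def vec_eq_iff join_def split: sum.split)

lemma pos_deriv: "(pos t p q has_vector_derivative - q) (at \<tau> within S)"
  unfolding pos_def[abs_def] by (auto intro!: derivative_eq_intros)

lemma u_integral_deriv:
  assumes "t0 \<le> t" "\<tau> \<in> {t..T}"
  shows "((\<lambda>\<tau>. integral {t..\<tau>} u) has_vector_derivative u \<tau>) (at \<tau> within {t..T})"
  by (rule integral_has_vector_derivative[OF continuous_on_subset assms(2)])
    (use u assms(1) in \<open>auto simp: bdd_cont_on_def\<close>)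

lemma fourth_block_deriv:
  assumes "t0 \<le> t" "\<tau> \<in> {t..T}"
  shows "(fourth_block t q a e has_vector_derivative - (\<chi> _. u \<tau> \<bullet> q) - e) (at \<tau> within {t..T})"
proof -
  have "((\<lambda>\<tau>. \<chi> _. integral {t..\<tau>} u \<bullet> q) has_vector_derivative (\<chi> _. u \<tau> \<bullet> q)) (at \<tau> within {t..T})"
    by (rule has_vector_derivative_vec_lambda
        bounded_linear.has_vector_derivative[OF bounded_linear_inner_left] u_integral_deriv assms)+
  moreover have "((\<lambda>\<tau>. a - (\<tau> - t) *\<^sub>R e) has_vector_derivative - e) (at \<tau> within {t..T})"
    by (auto intro!: derivative_eq_intros)
  ultimately show ?thesis
    unfolding fourth_block_def[abs_def] minus_diff_commute[of _ e] by (rule has_vector_derivative_diff[rotated])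
qed

lemma range_rate_cont:
  assumes "t0 \<le> t"
  shows "continuous_on {t..T} (range_rate t p q a e i)"
proof -
  have sub: "continuous_on {t..T} f" if "continuous_on {t0..} f" for f :: "real \<Rightarrow> 'z::topological_space"
    by (rule continuous_on_subset[OF that]) (use assms in auto)
  have "continuous_on {t..T} (pos t p q)" "continuous_on {t..T} (fourth_block t q a e)"
    using pos_deriv fourth_block_deriv[OF assms]
    by (meson has_vector_derivative_continuous continuous_on_eq_continuous_within)+
  moreover have "continuous_on {t..T} \<omega>" "continuous_on {t..T} u" "continuous_on {t..T} R"
    "continuous_on {t..T} (\<rho> i)"
    using \<omega> u R_cont \<rho>_cont by (auto simp: bdd_cont_on_def intro: sub)
  moreover have "\<forall>\<tau>\<in>{t..T}. \<rho> i \<tau> \<noteq> 0"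
    using \<rho>_pos[of _ i] assms by (metis atLeastAtMost_iff less_irrefl order.trans)
  ultimately show ?thesis
    unfolding range_rate_def[abs_def] range_drift_def
    by (intro continuous_intros bounded_bilinear.continuous_on[OF bounded_bilinear_matrix_vector_mult]
       bounded_linear.continuous_on[OF bounded_linear_transpose]
       bounded_linear.continuous_on[OF bounded_linear_skew]
       bounded_linear.continuous_on[OF bounded_linear_vec_nth])
qed

lemma ranges_deriv:
  assumes "t0 \<le> t" "\<tau> \<in> {t..T}"
  shows "(ranges t p q d a e has_vector_derivative (\<chi> i. range_rate t p q a e i \<tau>)) (at \<tau> within {t..T})"
proof -
  have "((\<lambda>\<tau>. d $ i + integral {t..\<tau>} (range_rate t p q a e i)) has_vector_derivative
      0 + range_rate t p q a e i \<tau>) (at \<tau> within {t..T})" for i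
    by (intro has_vector_derivative_add has_vector_derivative_const
        integral_has_vector_derivative range_rate_cont assms)
  then show ?thesis
    unfolding ranges_def[abs_def] by (intro has_vector_derivative_vec_lambda) simp
qed

lemma trajectory_ode:
  assumes "t0 \<le> t" "\<tau> \<in> {t..T}"
  shows "(trajectory t p q d a e has_vector_derivative
    sys_A b R \<omega> u \<rho> \<tau> *v trajectory t p q d a e \<tau>) (at \<tau> within {t..T})"
  unfolding trajectory_def[abs_def] sys_A_mult range_rate_def[symmetric]
  by (intro has_vector_derivative_join pos_deriv has_vector_derivative_const ranges_deriv fourth_block_deriv assms)

section \<open>Estimates on the output and the drift\<close>

text \<open>Pointwise in time: the rows of \<open>C_0\<close> recover x3; subtracting x3 from the
  pair rows leaves the products of the receiver differences with the rotated x1, divided by a sum of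
  ranges. Non-coplanarity bounds the rotated x1, and the rotation preserves its norm.\<close>

lemma output_bounds:
  obtains K where "K > 0"
    "\<And>t x1 x2 x3 x4 x5 i. t0 \<le> t \<Longrightarrow>
       \<bar>x3 $ i\<bar> \<le> 2 * norm (sys_C b R \<rho> t *v (x1 @@@ x2 @@@ x3 @@@ x4 @@@ x5))"
    "\<And>t x1 x2 x3 x4 x5. t0 \<le> t \<Longrightarrow>
       norm x1 \<le> K * norm (sys_C b R \<rho> t *v (x1 @@@ x2 @@@ x3 @@@ x4 @@@ x5))"
proof -
  obtain K where K: "K > 0" "\<And>z m. (\<And>i j. \<bar>(b i - b j) \<bullet> z\<bar> \<le> m) \<Longrightarrow> norm z \<le> K * m"
    using noncoplanar_norm_bound[OF noncoplanar] by blast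
  have 1: "\<bar>x3 $ i\<bar> \<le> 2 * norm (sys_C b R \<rho> t *v (x1 @@@ x2 @@@ x3 @@@ x4 @@@ x5))" for t x1 x2 x3 x4 x5 i
  proof -
    define y where "y = sys_C b R \<rho> t *v (x1 @@@ x2 @@@ x3 @@@ x4 @@@ x5)"
    have "y $ Inl (Min UNIV) = x3 $ Min UNIV"
      by (simp add: y_def sys_C_mult)
    moreover have "i = Min UNIV \<or> y $ Inl i = x3 $ Min UNIV - x3 $ i"
      by (simp add: y_def sys_C_mult)
    moreover have "\<bar>y $ Inl (Min UNIV)\<bar> \<le> norm y" "\<bar>y $ Inl i\<bar> \<le> norm y"
      by (rule component_le_norm_cart)+
    ultimately have "\<bar>x3 $ i\<bar> \<le> 2 * norm y" by (smt (verit))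
    then show ?thesis by (simp add: y_def)
  qed
  have 2: "norm x1 \<le> 5 * K * Rmax * norm (sys_C b R \<rho> t *v (x1 @@@ x2 @@@ x3 @@@ x4 @@@ x5))"
    if t: "t0 \<le> t" for t x1 x2 x3 x4 x5
  proof -
    define y where "y = sys_C b R \<rho> t *v (x1 @@@ x2 @@@ x3 @@@ x4 @@@ x5)"
    define z where "z = transpose (R t) *v x1"
    have x3: "\<bar>x3 $ i\<bar> \<le> 2 * norm y" for i unfolding y_def by (rule 1)
    have lt: "\<bar>(b i - b j) \<bullet> z\<bar> \<le> 5 * Rmax * norm y" if "i < j" for i j
    proof -
      define w where "w = 2 / (\<rho> i t + \<rho> j t) * ((b i - b j) \<bullet> z)"
      have "y $ Inr (Abs_receiver_pair (i, j)) = w + (x3 $ i - x3 $ j)"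
        using that by (simp add: y_def sys_C_mult Abs_receiver_pair_inverse z_def w_def del: transpose_matrix_vector)
      moreover have "\<bar>y $ Inr (Abs_receiver_pair (i, j))\<bar> \<le> norm y"
        by (rule component_le_norm_cart)
      \<comment> \<open>One \<open>norm y\<close> for the pair row and two for each of the two
        components of x3.\<close>
      ultimately have w: "\<bar>w\<bar> \<le> 5 * norm y"
        using x3[of i] x3[of j] by linarith
      have r: "0 < \<rho> i t + \<rho> j t" "\<rho> i t + \<rho> j t \<le> 2 * Rmax"
        using \<rho>_bounds[OF t, of i] \<rho>_bounds[OF t, of j] Rmin_pos by linarith+
      have "(b i - b j) \<bullet> z = (\<rho> i t + \<rho> j t) / 2 * w"
        using r by (simp add: w_def)
      then have "\<bar>(b i - b j) \<bullet> z\<bar> = (\<rho> i t + \<rho> j t) / 2 * \<bar>w\<bar>"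
        using r by (simp only: abs_mult) simp
      also have "\<dots> \<le> Rmax * (5 * norm y)"
        using r w Rmax_pos by (intro mult_mono) auto
      finally show ?thesis by simp
    qed
    have "norm z \<le> K * (5 * Rmax * norm y)"
    proof (rule K(2))
      fix i j
      show "\<bar>(b i - b j) \<bullet> z\<bar> \<le> 5 * Rmax * norm y"
      proof (cases i j rule: linorder_cases)
        case less
        then show ?thesis by (rule lt)
      next
        case equal
        then show ?thesis using Rmax_pos by simp
      next
        case greater
        then show ?thesis using lt[of j i] by (simp add: inner_diff_left)
      qed
    qed
    then show ?thesis
      using norm_transpose_R[OF t, of x1] by (simp add: z_def y_def del: transpose_matrix_vector)
  qed
  show ?thesis
    by (rule that[of "5 * K * Rmax", OF _ 1 2]) (use K(1) Rmax_pos in simp_all)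
qed

lemma drift_bounds:
  obtains M where "M > 0" "\<And>t i. t0 \<le> t \<Longrightarrow> \<bar>\<rho>' i t\<bar> \<le> M" "\<And>t. t0 \<le> t \<Longrightarrow> norm (u t) \<le> M"
    "\<And>t i p q. t0 \<le> t \<Longrightarrow> \<bar>range_drift b R \<omega> u i t p q\<bar> \<le> M * (norm p + norm q)"
proof -
  obtain U where U: "U > 0" "\<And>t. t0 \<le> t \<Longrightarrow> norm (u t) \<le> U"
    using bdd_cont_on_bounded[OF u] by auto
  have "bounded ((\<lambda>t. skew (\<omega> t)) ` {t0..})"
    using bdd_cont_on_linear[OF bounded_linear_skew \<omega>] by (simp add: bdd_cont_on_def)
  from norm_matrix_vector_mult_bounded[OF this]
  obtain W where W: "W > 0" "\<And>t z. t0 \<le> t \<Longrightarrow> norm (skew (\<omega> t) *v z) \<le> W * norm z" by auto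
  have "\<exists>B. \<forall>t\<ge>t0. \<bar>\<rho>' i t\<bar> \<le> B" for i
    using \<rho>'_bounded[of i] by (auto simp: bounded_iff)
  then obtain P where P: "\<And>i t. t0 \<le> t \<Longrightarrow> \<bar>\<rho>' i t\<bar> \<le> P i" by metis
  define N where "N = (\<Sum>i\<in>UNIV. norm (b i))"
  \<comment> \<open>Summing over the finitely many receivers turns the separate bounds on the
    derivatives \<open>\<rho>' i\<close> into one bound.\<close>
  define Q where "Q = (\<Sum>i\<in>UNIV. \<bar>P i\<bar>)"
  have bN: "norm (b i) \<le> N" for i
    unfolding N_def by (rule member_le_sum) auto
  have PQ: "\<bar>P i\<bar> \<le> Q" for i
    unfolding Q_def by (rule member_le_sum[where f = "\<lambda>i. \<bar>P i\<bar>"]) auto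
  have N0: "0 \<le> N" and Q0: "0 \<le> Q" using bN PQ by (meson abs_ge_zero norm_ge_zero order.trans)+
  define M where "M = Q + U + N * W + N"
  have NW: "0 \<le> N * W" using N0 W by simp
  have drift: "\<bar>range_drift b R \<omega> u i t p q\<bar> \<le> M * (norm p + norm q)" if t: "t0 \<le> t" for i t p q
  proof -
    have "\<bar>b i \<bullet> (skew (\<omega> t) *v (transpose (R t) *v p))\<bar> \<le> norm (b i) * norm (skew (\<omega> t) *v (transpose (R t) *v p))"
      by (rule Cauchy_Schwarz_ineq2)
    also have "\<dots> \<le> N * (W * norm p)"
      using W(2)[OF t, of "transpose (R t) *v p"] bN[of i] N0
      unfolding norm_transpose_R[OF t] by (intro mult_mono) auto
    finally have 1: "\<bar>b i \<bullet> (skew (\<omega> t) *v (transpose (R t) *v p))\<bar> \<le> N * W * norm p" by simp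
    have 2: "\<bar>u t \<bullet> p\<bar> \<le> U * norm p"
      using U(2)[OF t] by (intro order.trans[OF Cauchy_Schwarz_ineq2] mult_right_mono) auto
    have "\<bar>b i \<bullet> (transpose (R t) *v q)\<bar> \<le> norm (b i) * norm (transpose (R t) *v q)"
      by (rule Cauchy_Schwarz_ineq2)
    also have "\<dots> \<le> N * norm q"
      unfolding norm_transpose_R[OF t] using bN by (intro mult_right_mono) auto
    finally have 3: "\<bar>b i \<bullet> (transpose (R t) *v q)\<bar> \<le> N * norm q" .
    have "\<bar>range_drift b R \<omega> u i t p q\<bar> \<le> (N * W + U) * norm p + N * norm q"
      unfolding range_drift_def distrib_right using 1 2 3 by linarith
    also have "\<dots> \<le> M * norm p + M * norm q"
    proof (intro add_mono mult_right_mono)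
      show "N * W + U \<le> M" "N \<le> M" unfolding M_def using N0 Q0 NW U(1) by linarith+
    qed auto
    finally show ?thesis by (simp add: distrib_left)
  qed
  show ?thesis
  proof (rule that[of M])
    show "0 < M" unfolding M_def using N0 Q0 NW U by linarith
    show "\<bar>\<rho>' i t\<bar> \<le> M" if "t0 \<le> t" for t i
      unfolding M_def using P[OF that, of i] PQ[of i] N0 NW U(1) by linarith
    show "norm (u t) \<le> M" if "t0 \<le> t" for t
      unfolding M_def using U(2)[OF that] Q0 N0 NW by linarith
  qed (rule drift)
qed

text \<open>The output controls every \<open>x\<^sub>3\<close> component and, through the differences \<open>b i - b j\<close>, the norm of
  \<open>x\<^sub>1\<close>, hence the initial blocks \<open>p\<close> and \<open>q\<close> of the affine function \<open>x\<^sub>1\<close>. The remaining blocks are the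
  coefficients of the quadratic \<open>Q\<close> below: \<open>\<rho> i * x\<^sub>3 $ i - Q\<close> vanishes at \<open>t\<close>, and its derivative
  involves only quantities that are already under control.\<close>

lemma gramian_lower_bound:
  obtains \<alpha> where "\<alpha> > 0"
    "\<And>t p q d a e. t0 \<le> t \<Longrightarrow> \<alpha> * (norm (p @@@ q @@@ d @@@ a @@@ e))\<^sup>2 \<le>
       integral {t..t + 1} (\<lambda>\<tau>. (norm (sys_C b R \<rho> \<tau> *v trajectory t p q d a e \<tau>))\<^sup>2)"
proof -
  obtain K where K: "K > 0"
    "\<And>t x1 x2 x3 x4 x5 i. t0 \<le> t \<Longrightarrow>
       \<bar>x3 $ i\<bar> \<le> 2 * norm (sys_C b R \<rho> t *v (x1 @@@ x2 @@@ x3 @@@ x4 @@@ x5))"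
    "\<And>t x1 x2 x3 x4 x5. t0 \<le> t \<Longrightarrow>
       norm x1 \<le> K * norm (sys_C b R \<rho> t *v (x1 @@@ x2 @@@ x3 @@@ x4 @@@ x5))"
    using output_bounds by blast
  obtain M where M: "M > 0" "\<And>t i. t0 \<le> t \<Longrightarrow> \<bar>\<rho>' i t\<bar> \<le> M" "\<And>t. t0 \<le> t \<Longrightarrow> norm (u t) \<le> M"
    "\<And>t i p q. t0 \<le> t \<Longrightarrow> \<bar>range_drift b R \<omega> u i t p q\<bar> \<le> M * (norm p + norm q)"
    using drift_bounds by blast
  \<comment> \<open>Dominates both coefficients in the bound on \<open>D'\<close> below: 2M + MK in
    front of the output and 2M in front of \<open>norm q\<close>.\<close>
  define L where "L = 2 * M + M * K"
  have L: "L > 0" using M(1) K(1) by (simp add: L_def add_pos_pos)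
  \<comment> \<open>The leading 3 comes from squaring a sum of three terms: \<rho>_i x3_i, the
    accumulated output and \<open>norm q\<close>; the last is at most 12 K^2 times the energy when
    squared.\<close>
  define N where "N = 3 * (4 * Rmax\<^sup>2 + L\<^sup>2 + L\<^sup>2 * (12 * K\<^sup>2))"
  have N: "N > 0" unfolding N_def using Rmax_pos by (intro mult_pos_pos add_pos_nonneg) auto
  \<comment> \<open>The sum of the block constants: 8 + 12 for \<open>p\<close> and
    \<open>q\<close>, one term per receiver for \<open>d\<close>, and 1000 + 4000 for
    \<open>a\<close> and \<open>e\<close>.\<close>
  define Z where "Z = 20 * K\<^sup>2 + CARD('n) * (1000 * N / Rmin\<^sup>2) + 5000 * N"
  have Z: "Z > 0" unfolding Z_def using K(1) N Rmin_pos
    by (intro add_nonneg_pos add_nonneg_nonneg mult_nonneg_nonneg mult_pos_pos divide_nonneg_nonneg) auto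
  have main: "(norm (p @@@ q @@@ d @@@ a @@@ e))\<^sup>2 \<le>
       Z * integral {t..t + 1} (\<lambda>\<tau>. (norm (sys_C b R \<rho> \<tau> *v trajectory t p q d a e \<tau>))\<^sup>2)"
    if t: "t0 \<le> t" for t p q d a e
  proof -
    define x3 where "x3 = ranges t p q d a e"
    define y where "y \<tau> = norm (sys_C b R \<rho> \<tau> *v trajectory t p q d a e \<tau>)" for \<tau>
    define E where "E = integral {t..t + 1} (\<lambda>\<tau>. (y \<tau>)\<^sup>2)"
    \<comment> \<open>The remainder \<open>D\<close> is bounded by integrating its derivative, which
      involves the output to the first power; hence the mean of \<open>y\<close> appears beside its
      energy.\<close>
    define m where "m = integral {t..t + 1} y"
    have y0: "0 \<le> y \<tau>" for \<tau> by (simp add: y_def)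
    have x3_le: "\<bar>x3 \<tau> $ i\<bar> \<le> 2 * y \<tau>" and pos_le: "norm (pos t p q \<tau>) \<le> K * y \<tau>" if "t \<le> \<tau>" for i \<tau>
      unfolding y_def trajectory_def x3_def using K(2,3)[of \<tau>] t that by auto
    have traj_cont: "continuous_on {t..t + 1} (trajectory t p q d a e)"
      using trajectory_ode[OF t] has_vector_derivative_continuous
      by (meson continuous_on_eq_continuous_within)
    have "continuous_on {t..t + 1} (sys_C b R \<rho>)"
      using sys_C_bdd t unfolding bdd_cont_on_def by (auto elim: continuous_on_subset)
    then have y_cont: "continuous_on {t..t + 1} y"
      unfolding y_def[abs_def] using traj_cont
      by (intro continuous_intros bounded_bilinear.continuous_on[OF bounded_bilinear_matrix_vector_mult])
    have y2_int: "((\<lambda>\<tau>. (y \<tau>)\<^sup>2) has_integral E) {t..t + 1}"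
      unfolding E_def by (intro integrable_integral integrable_continuous_interval continuous_intros y_cont)
    have mE: "m\<^sup>2 \<le> E"
      unfolding m_def E_def by (rule integral_power2_le[OF y_cont])
    have E0: "0 \<le> E" using mE by (meson order.trans zero_le_power2)
    define I where "I = integral {t..t + 1} (\<lambda>\<tau>. (norm (p - (\<tau> - t) *\<^sub>R q))\<^sup>2)"
    have I: "((\<lambda>\<tau>. (norm (p - (\<tau> - t) *\<^sub>R q))\<^sup>2) has_integral I) {t..t + 1}"
      unfolding I_def by (intro integrable_integral integrable_continuous_interval continuous_intros)
    have "I \<le> K\<^sup>2 * E"
    proof (rule has_integral_le[OF I has_integral_mult_right[OF y2_int]])
      show "(norm (p - (\<tau> - t) *\<^sub>R q))\<^sup>2 \<le> K\<^sup>2 * (y \<tau>)\<^sup>2" if "\<tau> \<in> {t..t + 1}" for \<tau>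
        using power_mono[OF pos_le[of \<tau>], of 2] that by (simp add: pos_def power_mult_distrib)
    qed
    then have p: "(norm p)\<^sup>2 \<le> 8 * K\<^sup>2 * E" and q: "(norm q)\<^sup>2 \<le> 12 * K\<^sup>2 * E"
      using affine_L2_lower_bound[OF I] by linarith+
    have blocks: "(d $ i)\<^sup>2 \<le> 1000 * N / Rmin\<^sup>2 * E" "(norm a)\<^sup>2 \<le> 1000 * N * E" "(norm e)\<^sup>2 \<le> 4000 * N * E" for i
    proof -
      \<comment> \<open>The derivative of \<rho>_i x3_i contains -x4, whose part independent of
        \<open>u\<close> is -a + (\<tau> - t) e. \<open>Q\<close> is the antiderivative of that part
        starting from \<rho>_i(t) d_i, so \<open>a\<close> and \<open>e\<close> cancel in the
        derivative of \<open>D\<close>.\<close>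
      define Q where "Q \<tau> = \<rho> i t * d $ i + (\<tau> - t) * (- a $ 1) + (\<tau> - t)\<^sup>2 * (e $ 1 / 2)" for \<tau>
      define D where "D \<tau> = \<rho> i \<tau> * x3 \<tau> $ i - Q \<tau>" for \<tau>
      define D' where "D' \<tau> = \<rho>' i \<tau> * x3 \<tau> $ i + range_drift b R \<omega> u i \<tau> (pos t p q \<tau>) q
        + integral {t..\<tau>} u \<bullet> q" for \<tau>
      have D_deriv: "(D has_vector_derivative D' \<tau>) (at \<tau> within {t..T})" if "\<tau> \<in> {t..T}" for \<tau> T
      proof -
        have \<tau>: "t0 \<le> \<tau>" using that t by auto
        then have \<rho>0: "\<rho> i \<tau> > 0" using \<rho>_bounds[of \<tau> i] Rmin_pos by linarith
        have 1: "((\<lambda>\<tau>. x3 \<tau> $ i) has_real_derivative range_rate t p q a e i \<tau>) (at \<tau> within {t..T})"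
          unfolding has_real_derivative_iff_has_vector_derivative x3_def
          using has_vector_derivative_vec_nth[OF ranges_deriv[OF t that], where i = i] by simp
        have 2: "(\<rho> i has_real_derivative \<rho>' i \<tau>) (at \<tau> within {t..T})"
          by (rule DERIV_subset[OF \<rho>_deriv[OF \<tau>]]) (use t in auto)
        have "(D has_real_derivative (\<rho>' i \<tau> * x3 \<tau> $ i + \<rho> i \<tau> * range_rate t p q a e i \<tau>
            - (- a $ 1 + (\<tau> - t) * e $ 1))) (at \<tau> within {t..T})"
        proof -
          have "(Q has_real_derivative - a $ 1 + (\<tau> - t) * e $ 1) (at \<tau> within {t..T})"
            unfolding Q_def[abs_def] by (auto intro!: derivative_eq_intros)
          from DERIV_diff[OF DERIV_mult[OF 2 1] this] show ?thesis
            unfolding D_def[abs_def] by (simp add: algebra_simps)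
        qed
        moreover have "\<rho> i \<tau> * range_rate t p q a e i \<tau> =
            range_drift b R \<omega> u i \<tau> (pos t p q \<tau>) q - fourth_block t q a e \<tau> $ 1"
          using \<rho>0 by (simp add: range_rate_def)
        ultimately show ?thesis
          by (simp add: D'_def fourth_block_def algebra_simps flip: has_real_derivative_iff_has_vector_derivative)
      qed
      have D'_le: "norm (D' \<tau>) \<le> L * (y \<tau> + norm q)" if "\<tau> \<in> {t..t + 1}" for \<tau>
      proof -
        have \<tau>: "t0 \<le> \<tau>" "t \<le> \<tau>" "\<tau> \<le> t + 1" using that t by auto
        have "norm (integral {t..\<tau>} u) \<le> M * (\<tau> - t)"
          using \<tau> t M(3) u by (intro integral_bound) (auto simp: bdd_cont_on_def elim: continuous_on_subset)
        also have "\<dots> \<le> M" using \<tau> M(1) by (simp add: mult_left_le)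
        finally have 1: "\<bar>integral {t..\<tau>} u \<bullet> q\<bar> \<le> M * norm q"
          by (intro order.trans[OF Cauchy_Schwarz_ineq2] mult_right_mono) auto
        have 2: "\<bar>\<rho>' i \<tau> * x3 \<tau> $ i\<bar> \<le> M * (2 * y \<tau>)"
          unfolding abs_mult using M(1) M(2)[OF \<tau>(1)] x3_le[OF \<tau>(2)] by (intro mult_mono) auto
        have "\<bar>range_drift b R \<omega> u i \<tau> (pos t p q \<tau>) q\<bar> \<le> M * (norm (pos t p q \<tau>) + norm q)"
          by (rule M(4)[OF \<tau>(1)])
        also have "\<dots> \<le> M * (K * y \<tau> + norm q)"
          using M(1) pos_le[OF \<tau>(2)] by (intro mult_left_mono) auto
        finally have "norm (D' \<tau>) \<le> L * y \<tau> + 2 * M * norm q"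
          using 1 2 by (simp add: D'_def L_def algebra_simps)
        also have "\<dots> \<le> L * y \<tau> + L * norm q"
          using M(1) K(1) y0 by (intro add_mono mult_right_mono) (auto simp: L_def)
        finally show ?thesis by (simp add: distrib_left)
      qed
      have D_le: "\<bar>D \<tau>\<bar> \<le> L * (m + norm q)" if "\<tau> \<in> {t..t + 1}" for \<tau>
      \<comment> \<open>The comparison rule for derivatives used below works on a nondegenerate
        interval, so the initial time is treated apart.\<close>
      proof (cases "\<tau> = t")
        case True
        have "0 \<le> m" unfolding m_def
          using y0 y_cont by (intro integral_nonneg integrable_continuous_interval) auto
        moreover have "D t = 0"
          by (simp add: D_def Q_def x3_def ranges_def)
        ultimately show ?thesis using True L by simp
      next
        case False
        then have \<tau>: "t < \<tau>" "\<tau> \<le> t + 1" using that by auto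
        \<comment> \<open>The bound on \<open>D'\<close> varies with the output, which is small in
          mean but not pointwise. Comparing with its antiderivative, in place of a Lipschitz
          constant, keeps the estimate in terms of \<open>m\<close>.\<close>
        define \<phi> where "\<phi> \<sigma> = L * (integral {t..\<sigma>} y + (\<sigma> - t) * norm q)" for \<sigma>
        have y_cont': "continuous_on {t..\<tau>} y"
          by (rule continuous_on_subset[OF y_cont]) (use \<tau> in auto)
        have \<phi>_deriv: "(\<phi> has_vector_derivative L * (y \<sigma> + norm q)) (at \<sigma> within {t..\<tau>})" if "\<sigma> \<in> {t..\<tau>}" for \<sigma>
          unfolding \<phi>_def[abs_def] has_real_derivative_iff_has_vector_derivative[symmetric]
          by (rule DERIV_cmult DERIV_add integral_has_real_derivative[OF y_cont' that])+
            (auto intro!: derivative_eq_intros)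
        have "norm (D \<tau> - D t) \<le> \<phi> \<tau> - \<phi> t"
        proof (rule differentiable_bound_general[OF \<tau>(1)])
          show "continuous_on {t..\<tau>} D" "continuous_on {t..\<tau>} \<phi>"
            using D_deriv \<phi>_deriv
            by (meson has_vector_derivative_continuous continuous_on_eq_continuous_within)+
          fix \<sigma> assume \<sigma>: "t < \<sigma>" "\<sigma> < \<tau>"
          then show "(D has_vector_derivative D' \<sigma>) (at \<sigma>)"
            "(\<phi> has_vector_derivative L * (y \<sigma> + norm q)) (at \<sigma>)"
            using D_deriv[of \<sigma> \<tau>] \<phi>_deriv[of \<sigma>] by (simp_all add: at_within_Icc_at)
          show "norm (D' \<sigma>) \<le> L * (y \<sigma> + norm q)"
            using D'_le[of \<sigma>] \<sigma> \<tau> by auto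
        qed
        moreover have "D t = 0" "\<phi> t = 0"
          by (simp_all add: D_def Q_def x3_def ranges_def \<phi>_def)
        moreover have "\<phi> \<tau> \<le> L * (m + norm q)"
        proof -
          have "integral {t..\<tau>} y \<le> m"
            unfolding m_def using \<tau> y0 y_cont y_cont'
            by (intro integral_subset_le integrable_continuous_interval) auto
          moreover have "(\<tau> - t) * norm q \<le> norm q"
            using \<tau> by (simp add: mult_left_le_one_le)
          ultimately show ?thesis unfolding \<phi>_def using L by (intro mult_left_mono add_mono) auto
        qed
        ultimately show ?thesis by simp
      qed
      have Q_le: "(Q \<tau>)\<^sup>2 \<le> 3 * (4 * Rmax\<^sup>2) * (y \<tau>)\<^sup>2 + 3 * (L\<^sup>2 * m\<^sup>2 + L\<^sup>2 * (norm q)\<^sup>2)"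
        if "\<tau> \<in> {t..t + 1}" for \<tau>
      proof -
        have \<tau>: "t0 \<le> \<tau>" "t \<le> \<tau>" using that t by auto
        have "\<bar>\<rho> i \<tau> * x3 \<tau> $ i\<bar> \<le> Rmax * (2 * y \<tau>)"
          unfolding abs_mult using \<rho>_bounds[OF \<tau>(1), of i] Rmin_pos x3_le[OF \<tau>(2)] by (intro mult_mono) auto
        then have "\<bar>Q \<tau>\<bar> \<le> 2 * Rmax * y \<tau> + L * m + L * norm q"
          using D_le[OF that] by (simp add: D_def distrib_left)
        then have "(Q \<tau>)\<^sup>2 \<le> (2 * Rmax * y \<tau> + L * m + L * norm q)\<^sup>2"
          by (simp add: abs_le_square_iff[symmetric])
        also have "\<dots> \<le> 3 * ((2 * Rmax * y \<tau>)\<^sup>2 + (L * m)\<^sup>2 + (L * norm q)\<^sup>2)"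
        proof -
          have "(r + s + w)\<^sup>2 \<le> 3 * (r\<^sup>2 + s\<^sup>2 + w\<^sup>2)" for r s w :: real
          proof -
            have "3 * (r\<^sup>2 + s\<^sup>2 + w\<^sup>2) - (r + s + w)\<^sup>2 = (r - s)\<^sup>2 + (r - w)\<^sup>2 + (s - w)\<^sup>2"
              by algebra
            then show ?thesis by (smt (verit) zero_le_power2)
          qed
          then show ?thesis .
        qed
        finally show ?thesis by (simp add: power_mult_distrib algebra_simps)
      qed
      define J where "J = integral {t..t + 1} (\<lambda>\<tau>. (Q \<tau>)\<^sup>2)"
      have J: "((\<lambda>\<tau>. (Q \<tau>)\<^sup>2) has_integral J) {t..t + 1}"
        unfolding J_def Q_def by (intro integrable_integral integrable_continuous_interval continuous_intros)
      have "J \<le> 3 * (4 * Rmax\<^sup>2) * E + 3 * (L\<^sup>2 * m\<^sup>2 + L\<^sup>2 * (norm q)\<^sup>2)"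
        using has_integral_const_real[of "3 * (L\<^sup>2 * m\<^sup>2 + L\<^sup>2 * (norm q)\<^sup>2)" t "t + 1"]
        by (intro has_integral_le[OF J has_integral_add[OF has_integral_mult_right[OF y2_int]] Q_le]) auto
      also have "\<dots> \<le> 3 * (4 * Rmax\<^sup>2) * E + 3 * (L\<^sup>2 * E + L\<^sup>2 * (12 * K\<^sup>2 * E))"
        using mE q by (intro add_left_mono mult_left_mono add_mono) auto
      also have "\<dots> = N * E" by (simp add: N_def algebra_simps)
      finally have JN: "J \<le> N * E" .
      note bds = quadratic_L2_lower_bound[OF J[unfolded Q_def]]
      \<comment> \<open>The constant coefficient of \<open>Q\<close> is \<rho>_i(t) d_i; the lower
        bound on the ranges releases d_i.\<close>
      have "(Rmin * d $ i)\<^sup>2 \<le> (\<rho> i t * d $ i)\<^sup>2"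
        unfolding power_mult_distrib using \<rho>_bounds[OF t, of i] Rmin_pos
        by (intro mult_right_mono power_mono) auto
      then have "Rmin\<^sup>2 * (d $ i)\<^sup>2 \<le> 1000 * (N * E)"
        using bds(1) JN unfolding power_mult_distrib by linarith
      then show "(d $ i)\<^sup>2 \<le> 1000 * N / Rmin\<^sup>2 * E"
        using Rmin_pos by (simp add: pos_le_divide_eq mult.commute)
      have norm1: "(norm z)\<^sup>2 = (z $ 1)\<^sup>2" for z :: "real^1"
        by (simp add: norm_vec_def UNIV_1)
      \<comment> \<open>The leading coefficient of \<open>Q\<close> is half of \<open>e\<close>,
        whence 4000 instead of 1000.\<close>
      show "(norm a)\<^sup>2 \<le> 1000 * N * E" "(norm e)\<^sup>2 \<le> 4000 * N * E"
        unfolding norm1 using bds(2,3) JN by (simp_all add: power_divide)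
    qed
    have "(norm d)\<^sup>2 = (\<Sum>i\<in>UNIV. (d $ i)\<^sup>2)"
      unfolding power2_norm_eq_inner inner_vec_def by (simp add: power2_eq_square)
    also have "\<dots> \<le> (\<Sum>i\<in>(UNIV::'n set). 1000 * N / Rmin\<^sup>2 * E)"
      by (intro sum_mono blocks)
    finally have d: "(norm d)\<^sup>2 \<le> CARD('n) * (1000 * N / Rmin\<^sup>2) * E" by simp
    have "(norm (p @@@ q @@@ d @@@ a @@@ e))\<^sup>2 \<le> Z * E"
      unfolding norm_join_power2 Z_def using p q d blocks(2,3) by (simp add: algebra_simps)
    then show ?thesis by (simp add: E_def y_def)
  qed
  show ?thesis
  proof (rule that[of "1 / Z"])
    show "1 / Z * (norm (p @@@ q @@@ d @@@ a @@@ e))\<^sup>2 \<le>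
        integral {t..t + 1} (\<lambda>\<tau>. (norm (sys_C b R \<rho> \<tau> *v trajectory t p q d a e \<tau>))\<^sup>2)"
      if "t0 \<le> t" for t p q d a e
      using main[OF that, of p q d a e] Z by (simp add: pos_divide_le_eq mult.commute)
  qed (use Z in simp)
qed

section \<open>Uniform complete observability of the navigation system\<close>

lemma range_system_observable: "uniformly_completely_observable t0 (range_system b R \<omega> u \<rho>)"
proof -
  obtain \<alpha> where \<alpha>: "\<alpha> > 0"
    "\<And>t p q d a e. t0 \<le> t \<Longrightarrow> \<alpha> * (norm (p @@@ q @@@ d @@@ a @@@ e))\<^sup>2 \<le>
       integral {t..t + 1} (\<lambda>\<tau>. (norm (sys_C b R \<rho> \<tau> *v trajectory t p q d a e \<tau>))\<^sup>2)"
    using gramian_lower_bound by blast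
  define S where "S t c = trajectory t (fstv c) (fstv (sndv c)) (fstv (sndv (sndv c)))
    (fstv (sndv (sndv (sndv c)))) (sndv (sndv (sndv (sndv c))))" for t and c :: "real^'n state_index"
  show ?thesis
  proof (rule uniformly_completely_observableI[where S = S and \<alpha> = \<alpha> and \<delta> = 1])
    show "bounded (state_mat (range_system b R \<omega> u \<rho>) ` {t0..})"
      "bounded (output_mat (range_system b R \<omega> u \<rho>) ` {t0..})"
      "continuous_on {t0..} (output_mat (range_system b R \<omega> u \<rho>))"
      using sys_A_bdd sys_C_bdd by (simp_all add: range_system_def bdd_cont_on_def)
    show "S t c t = c" for t c by (simp add: S_def trajectory_init)
    show "(S t c has_vector_derivative state_mat (range_system b R \<omega> u \<rho>) \<tau> *v S t c \<tau>) (at \<tau> within {t..T})"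
      if "t0 \<le> t" "\<tau> \<in> {t..T}" for t c \<tau> T
      using trajectory_ode[OF that] by (simp add: S_def range_system_def)
    show "\<alpha> * (norm c)\<^sup>2 \<le> integral {t..t + 1} (\<lambda>\<tau>. (norm (output_mat (range_system b R \<omega> u \<rho>) \<tau> *v S t c \<tau>))\<^sup>2)"
      if "t0 \<le> t" for t c
      using \<alpha>(2)[OF that, of "fstv c" "fstv (sndv c)" "fstv (sndv (sndv c))"
        "fstv (sndv (sndv (sndv c)))" "sndv (sndv (sndv (sndv c)))"]
      by (simp add: S_def range_system_def)
  qed (use \<alpha>(1) in simp_all)
qed

end

theorem theorem4:
  fixes b :: "'n::{card2, linorder} \<Rightarrow> real^3"
    and R :: "real \<Rightarrow> real^3^3"
    and r r' \<omega> \<omega>' v v' v\<^sub>c v\<^sub>r u :: "real \<Rightarrow> real^3"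
    and Iv\<^sub>c :: "real^3"
    and \<rho> \<rho>' :: "'n \<Rightarrow> real \<Rightarrow> real"
    and t0 R\<^sub>m\<^sub>i\<^sub>n R\<^sub>m\<^sub>a\<^sub>x :: real
  assumes R_rot: "\<And>t. t \<ge> t0 \<Longrightarrow> rotation_matrix (R t)"
    and R_ode: "\<And>t. t \<ge> t0 \<Longrightarrow>
      (R has_vector_derivative R t ** skew (\<omega> t)) (at t within {t0..})"
    and v\<^sub>c_eq: "\<And>t. t \<ge> t0 \<Longrightarrow> v\<^sub>c t = transpose (R t) *v Iv\<^sub>c"
    and v\<^sub>c_ode: "\<And>t. t \<ge> t0 \<Longrightarrow>
      (v\<^sub>c has_vector_derivative - (skew (\<omega> t) *v v\<^sub>c t)) (at t within {t0..})"
    and v\<^sub>r_eq: "\<And>t. t \<ge> t0 \<Longrightarrow> v\<^sub>r t = v t - v\<^sub>c t"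
    and r_deriv: "\<And>t. t \<ge> t0 \<Longrightarrow> (r has_vector_derivative r' t) (at t within {t0..})"
    and r_ode: "\<And>t. t \<ge> t0 \<Longrightarrow> r' t = - (skew (\<omega> t) *v r t) - v\<^sub>c t - v\<^sub>r t"
    and \<rho>_eq: "\<And>i t. t \<ge> t0 \<Longrightarrow> \<rho> i t = norm (b i - r t)"
    and u_eq: "\<And>t. t \<ge> t0 \<Longrightarrow> u t = R t *v v\<^sub>r t"
    and u_cont: "continuous_on {t0..} u"
    and u_bdd: "bounded (u ` {t0..})"
    and noncoplanar: "\<exists>I. card I = 4 \<and> \<not> coplanar (b ` I)"
    and Rminmax_pos: "R\<^sub>m\<^sub>i\<^sub>n > 0" "R\<^sub>m\<^sub>a\<^sub>x > 0"
    and \<rho>_bounds: "\<And>i t. t \<ge> t0 \<Longrightarrow> R\<^sub>m\<^sub>i\<^sub>n \<le> \<rho> i t \<and> \<rho> i t \<le> R\<^sub>m\<^sub>a\<^sub>x"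
    and \<omega>_deriv: "\<And>t. t \<ge> t0 \<Longrightarrow> (\<omega> has_vector_derivative \<omega>' t) (at t within {t0..})"
    and v_deriv: "\<And>t. t \<ge> t0 \<Longrightarrow> (v has_vector_derivative v' t) (at t within {t0..})"
    and \<rho>_deriv: "\<And>i t. t \<ge> t0 \<Longrightarrow>
      (\<rho> i has_real_derivative \<rho>' i t) (at t within {t0..})"
    and signals_bdd: "bounded (r ` {t0..})" "bounded (\<omega> ` {t0..})" "bounded (v ` {t0..})"
    and derivs_bdd: "bounded (r' ` {t0..})" "bounded (\<omega>' ` {t0..})" "bounded (v' ` {t0..})"
      "\<And>i. bounded (\<rho>' i ` {t0..})"
  shows "uniformly_completely_observable t0 (range_system b R \<omega> u \<rho>)"
proof -
  \<comment> \<open>Coplanarity passes to subsets, so four non-coplanar receivers suffice for the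
    whole family.\<close>
  have "\<not> coplanar (range b)"
    using noncoplanar unfolding coplanar_def by (meson image_mono order.trans subset_UNIV)
  interpret range_signals b R \<omega> u \<rho> \<rho>' t0 R\<^sub>m\<^sub>i\<^sub>n R\<^sub>m\<^sub>a\<^sub>x
  proof
    show "orthogonal_matrix (R t)" if "t0 \<le> t" for t
      using R_rot[OF that] by (simp add: rotation_matrix_def)
    show "continuous_on {t0..} R"
      using R_ode by (meson atLeast_iff has_vector_derivative_continuous continuous_on_eq_continuous_within)
    have "continuous_on {t0..} \<omega>"
      using \<omega>_deriv by (meson atLeast_iff has_vector_derivative_continuous continuous_on_eq_continuous_within)
    then show "bdd_cont_on {t0..} \<omega>"
      using signals_bdd(2) by (simp add: bdd_cont_on_def)
    show "bdd_cont_on {t0..} u"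
      using u_cont u_bdd by (simp add: bdd_cont_on_def)
  qed (fact \<open>\<not> coplanar (range b)\<close> Rminmax_pos(1) \<rho>_bounds \<rho>_deriv derivs_bdd(4))+
  show ?thesis by (rule range_system_observable)
qed

end
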